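(* Let $\mathbb F$ be an algebraically closed field and let $q\in\mathbb F$ be nonzero and not a root of unity. Let $V$ denote an evaluation module for $\boxtimes_q$, with evaluation parameter $t$. Then the $\boxtimes_q$-module ${}^\rho V$ ($V$ twisted via $\rho$) is an evaluation module with evaluation parameter $t^{-1}$.
   Context: Algebras are associative with 1. $[n]_q=(q^n-q^{-n})/(q-q^{-1})$ and $\mathbb Z_4=\mathbb Z/4\mathbb Z$. The $q$-tetrahedron algebra $\boxtimes_q$ is the $\mathbb F$-algebra with generators (called the standard generators) $\{x_{ij}\mid i,j\in\mathbb Z_4,\ j-i=1\text{ or }j-i=2\}$ and relations: (i) $x_{ij}x_{ji}=1$ if $j-i=2$; (ii) $\frac{qx_{ij}x_{jk}-q^{-1}x_{jk}x_{ij}}{q-q^{-1}}=1$ if $(j-i,k-j)$ is one of $(1,1),(1,2),(2,1)$; (iii) $x_{ij}^3x_{k\ell}-[3]_qx_{ij}^2x_{k\ell}x_{ij}+[3]_qx_{ij}x_{k\ell}x_{ij}^2-x_{k\ell}x_{ij}^3=0$ if $j-i=k-j=\ell-k=1$. $\rho$ is the automorphism of $\boxtimes_q$ sending each standard generator $x_{ij}$ to $x_{i+1,j+1}$. For a $\boxtimes_q$-module $V$ and an automorphism $\pi$ of $\boxtimes_q$, $V$ twisted via $\pi$ (denoted ${}^\pi V$) is the $\boxtimes_q$-module on the vector space $V$ in which $\zeta\in\boxtimes_q$ acts as $\pi^{-1}(\zeta)$ acts on the original module $V$. Known fact: on a finite-dimensional irreducible $\boxtimes_q$-module $V$ there are $d\in\mathbb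 N$ (the diameter) and $\varepsilon\in\{1,-1\}$ (the type) such that each standard generator is diagonalizable with set of distinct eigenvalues $\{\varepsilon q^{d-2n}\mid 0\le n\le d\}$. If $V$ has type 1, the sequence of dimensions of the eigenspaces of $x_{ij}$ for eigenvalues $q^{d},q^{d-2},\dots,q^{-d}$ does not depend on $x_{ij}$; it is called the shape of $V$. The trivial $\boxtimes_q$-module is the one-dimensional module on which every standard generator acts as the identity. An evaluation module for $\boxtimes_q$ is a nontrivial finite-dimensional irreducible $\boxtimes_q$-module of type 1 and shape $(1,1,\dots,1)$ (so $d\ge1$ and $\dim V=d+1$). Matrices in ${\rm Mat}_{d+1}(\mathbb F)$ have rows and columns indexed by $0,\dots,d$; $M$ represents $A$ with respect to a basis $\{v_n\}_{n=0}^d$ when $Av_n=\sum_i M_{in}v_i$. Entries not mentioned below are $0$. A subscript $q^{-1}$ means that $q$ is replaced by $q^{-1}$ in the definition (and similarly $t^{-1}$ as argument). - $Z$: $(i,j)$-entry $\delta_{i+j,d}$. - $K_q$: diagonal, $(i,i)$-entry $q^{d-2i}$. - $E_q$: $(i,i)$-entry $q^{2i-d}$; $(i-1,i)$-entry $q^d-q^{2i-2-d}$. - $G_q(t)$: $(i,i)$-entry $q^{2i-d}$; $(i-1,i)$-entry $(q^d-q^{2i-2-d})(1-tq^{d-2i+1})$. - $L_q(t)$: $(i,i)$-entry $q^{2i-d}$; $(i-1,i)$-entry $(q^d-q^{2i-2-d})(1-tq^{d-2i+1})^{-1}$. - $S_q(t)$: $(i-1,i)$-entry $(q^d-q^{2i-d-2})(1-tq^{2i-d-1})$;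 $(i,i-1)$-entry $(q^{2i-d}-q^{-d})q^{2i-d-1}t$; $(i,i)$-entry $q^d-(q^{2i-d}-q^{-d})q^{2i-d-1}t-(q^d-q^{2i-d})(1-tq^{2i-d+1})$. For an integer $d\ge1$ and a nonzero $t\in\mathbb F$ not among $\{q^{d-2n+1}\}_{n=1}^d$, $\mathbf V_d(t)$ is the evaluation module for $\boxtimes_q$ having a basis with respect to which the standard generators are represented by: $x_{01}: ZS_{q^{-1}}(t^{-1})Z$, $x_{12}: E_q$, $x_{23}: K_q$, $x_{30}: ZG_{q^{-1}}(t)Z$, $x_{02}: L_q(t)$, $x_{13}: (ZE_{q^{-1}}Z)^{-1}$, $x_{20}: (L_q(t))^{-1}$, $x_{31}: ZE_{q^{-1}}Z$. Every evaluation module $V$ of diameter $d$ is isomorphic to $\mathbf V_d(t)$ for a unique such $t$, called the evaluation parameter of $V$. *)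

theory Defs
  imports
    "HOL-Library.Poly_Mapping"
    "HOL-Library.Numeral_Type"
    "HOL-Algebra.QuotRing"
    "HOL-Computational_Algebra.Polynomial"
    "Jordan_Normal_Form.Gauss_Jordan_Elimination"
begin

section \<open>The free algebra on the standard generators\<close>

text \<open>The type \<open>4\<close> of \<^theory>\<open>HOL-Library.Numeral_Type\<close> is the ring of integers modulo 4.\<close>

typedef std_idx = "{(i :: 4, j :: 4). j - i = 1 \<or> j - i = 2}"
  morphisms idx_pair std_idx
  by (rule exI[of _ "(0, 1)"]) simp

text \<open>
  Words form the free monoid, written additively because the convolution product of
  \<^theory>\<open>HOL-Library.Poly_Mapping\<close> expects an additive (here noncommutative) monoid of exponents.
  Finitely supported functions from words to the field then form the free associative algebra.
\<close>

datatype 'g word = Word (letters: "'g list")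

instantiation word :: (type) monoid_add
begin

definition zero_word :: "'a word" where
  "0 = Word []"

definition plus_word :: "'a word \<Rightarrow> 'a word \<Rightarrow> 'a word" where
  "u + v = Word (letters u @ letters v)"

instance
  by standard (simp_all add: zero_word_def plus_word_def)

end

type_synonym 'a free_elt = "std_idx word \<Rightarrow>\<^sub>0 'a"

definition free_scalar :: "'a::field \<Rightarrow> 'a free_elt" where
  "free_scalar c = Poly_Mapping.single 0 c"

definition free_gen :: "4 \<Rightarrow> 4 \<Rightarrow> 'a::field free_elt" where
  "free_gen i j = Poly_Mapping.single (Word [std_idx (i, j)]) 1"

definition free_alg :: "'a::field free_elt ring" where
  "free_alg = \<lparr>carrier = UNIV, monoid.mult = (*), one = 1, zero = 0, add = (+)\<rparr>"

lemma ring_free_alg: "ring (free_alg :: 'a::field free_elt ring)"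
proof (rule ringI)
  show "abelian_group (free_alg :: 'a free_elt ring)"
  proof (rule abelian_groupI)
    fix x :: "'a free_elt"
    show "\<exists>y\<in>carrier free_alg. y \<oplus>\<^bsub>free_alg\<^esub> x = \<zero>\<^bsub>free_alg\<^esub>"
      by (rule bexI[of _ "- x"]) (simp_all add: free_alg_def)
  qed (simp_all add: free_alg_def algebra_simps)
  show "Group.monoid (free_alg :: 'a free_elt ring)"
    by (rule monoidI) (simp_all add: free_alg_def algebra_simps)
qed (simp_all add: free_alg_def algebra_simps)


section \<open>The q-tetrahedron algebra\<close>

definition q_int :: "'a::field \<Rightarrow> nat \<Rightarrow> 'a" where
  "q_int q n = (q ^ n - inverse q ^ n) / (q - inverse q)"

definition tetra_rels :: "'a::field \<Rightarrow> 'a free_elt set" where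
  "tetra_rels q =
     {free_gen i j * free_gen j i - 1 | i j. j - i = 2} \<union>
     {free_scalar (1 / (q - inverse q)) *
        (free_scalar q * free_gen i j * free_gen j k
          - free_scalar (inverse q) * free_gen j k * free_gen i j) - 1
      | i j k. (j - i, k - j) \<in> {(1, 1), (1, 2), (2, 1)}} \<union>
     {free_gen i j ^ 3 * free_gen k l
        - free_scalar (q_int q 3) * free_gen i j ^ 2 * free_gen k l * free_gen i j
        + free_scalar (q_int q 3) * free_gen i j * free_gen k l * free_gen i j ^ 2
        - free_gen k l * free_gen i j ^ 3
      | i j k l. j - i = 1 \<and> k - j = 1 \<and> l - k = 1}"

definition tetra_ideal :: "'a::field \<Rightarrow> 'a free_elt set" where
  "tetra_ideal q = genideal free_alg (tetra_rels q)"

definition tetra :: "'a::field \<Rightarrow> 'a free_elt set ring" where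
  "tetra q = free_alg Quot tetra_ideal q"

lemma ring_tetra: "ring (tetra q)"
proof -
  interpret ring "free_alg :: 'a free_elt ring" by (rule ring_free_alg)
  have "ideal (tetra_ideal q) (free_alg :: 'a free_elt ring)"
    unfolding tetra_ideal_def by (rule genideal_ideal) (simp add: free_alg_def)
  then show ?thesis
    unfolding tetra_def by (rule ideal.quotient_is_ring)
qed

text \<open>
  The F-algebra structure is recorded by the images of the scalars \<open>c \<cdot> 1\<close> in the quotient;
  an F-algebra homomorphism is a ring homomorphism that respects them.
\<close>

definition tetra_scalar :: "'a::field \<Rightarrow> 'a \<Rightarrow> 'a free_elt set" where
  "tetra_scalar q c = tetra_ideal q +>\<^bsub>free_alg\<^esub> free_scalar c"

definition tetra_gen :: "'a::field \<Rightarrow> 4 \<Rightarrow> 4 \<Rightarrow> 'a free_elt set" where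
  "tetra_gen q i j = tetra_ideal q +>\<^bsub>free_alg\<^esub> free_gen i j"

definition std_gens :: "'a::field \<Rightarrow> 'a free_elt set set" where
  "std_gens q = {tetra_gen q i j | i j. j - i = 1 \<or> j - i = 2}"

definition tetra_automorphism ::
    "'a::field \<Rightarrow> ('a free_elt set \<Rightarrow> 'a free_elt set) \<Rightarrow> bool" where
  "tetra_automorphism q \<pi> \<longleftrightarrow>
     \<pi> \<in> ring_iso (tetra q) (tetra q) \<and> (\<forall>c. \<pi> (tetra_scalar q c) = tetra_scalar q c)"

definition is_rho :: "'a::field \<Rightarrow> ('a free_elt set \<Rightarrow> 'a free_elt set) \<Rightarrow> bool" where
  "is_rho q \<rho> \<longleftrightarrow> tetra_automorphism q \<rho> \<and>
     (\<forall>i j. j - i = 1 \<or> j - i = 2 \<longrightarrow> \<rho> (tetra_gen q i j) = tetra_gen q (i + 1) (j + 1))"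


section \<open>Modules\<close>

text \<open>
  A module consists of a vector space, given by its scalar multiplication \<open>scale\<close>, and the map
  \<open>act\<close> by which the elements of the algebra act. Only the values of \<open>act\<close> on the carrier of the
  algebra matter.
\<close>

definition tetra_module ::
    "'a::field \<Rightarrow> ('a \<Rightarrow> 'v::ab_group_add \<Rightarrow> 'v) \<Rightarrow> ('a free_elt set \<Rightarrow> 'v \<Rightarrow> 'v) \<Rightarrow> bool" where
  "tetra_module q scale act \<longleftrightarrow>
     vector_space scale \<and>
     (\<forall>\<zeta>\<in>carrier (tetra q). Vector_Spaces.linear scale scale (act \<zeta>)) \<and>
     (\<forall>\<zeta>\<in>carrier (tetra q). \<forall>\<eta>\<in>carrier (tetra q). \<forall>v.
        act (\<zeta> \<oplus>\<^bsub>tetra q\<^esub> \<eta>) v = act \<zeta> v + act \<eta> v) \<and>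
     (\<forall>\<zeta>\<in>carrier (tetra q). \<forall>\<eta>\<in>carrier (tetra q). \<forall>v.
        act (\<zeta> \<otimes>\<^bsub>tetra q\<^esub> \<eta>) v = act \<zeta> (act \<eta> v)) \<and>
     (\<forall>v. act \<one>\<^bsub>tetra q\<^esub> v = v) \<and>
     (\<forall>c v. act (tetra_scalar q c) v = scale c v)"

definition twist ::
    "'a::field \<Rightarrow> ('a free_elt set \<Rightarrow> 'a free_elt set) \<Rightarrow> ('a free_elt set \<Rightarrow> 'v \<Rightarrow> 'v)
      \<Rightarrow> 'a free_elt set \<Rightarrow> 'v \<Rightarrow> 'v" where
  "twist q \<pi> act = (\<lambda>\<zeta>. act (inv_into (carrier (tetra q)) \<pi> \<zeta>))"

definition module_isomorphic ::
    "'a::field \<Rightarrow> ('a \<Rightarrow> 'v::ab_group_add \<Rightarrow> 'v) \<Rightarrow> ('a free_elt set \<Rightarrow> 'v \<Rightarrow> 'v)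
      \<Rightarrow> ('a \<Rightarrow> 'w::ab_group_add \<Rightarrow> 'w) \<Rightarrow> ('a free_elt set \<Rightarrow> 'w \<Rightarrow> 'w) \<Rightarrow> bool" where
  "module_isomorphic q scale act scale' act' \<longleftrightarrow>
     (\<exists>f. Vector_Spaces.linear scale scale' f \<and> bij f \<and>
        (\<forall>\<zeta>\<in>carrier (tetra q). \<forall>v. f (act \<zeta> v) = act' \<zeta> (f v)))"

definition finite_dimensional :: "('a::field \<Rightarrow> 'v::ab_group_add \<Rightarrow> 'v) \<Rightarrow> bool" where
  "finite_dimensional scale \<longleftrightarrow> (\<exists>B. finite B \<and> module.span scale B = UNIV)"

definition irreducible_module ::
    "'a::field \<Rightarrow> ('a \<Rightarrow> 'v::ab_group_add \<Rightarrow> 'v) \<Rightarrow> ('a free_elt set \<Rightarrow> 'v \<Rightarrow> 'v) \<Rightarrow> bool" where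
  "irreducible_module q scale act \<longleftrightarrow>
     (UNIV :: 'v set) \<noteq> {0} \<and>
     (\<forall>W. module.subspace scale W \<and> (\<forall>\<zeta>\<in>carrier (tetra q). \<forall>w\<in>W. act \<zeta> w \<in> W)
        \<longrightarrow> W = {0} \<or> W = UNIV)"

definition trivial_module ::
    "'a::field \<Rightarrow> ('a \<Rightarrow> 'v::ab_group_add \<Rightarrow> 'v) \<Rightarrow> ('a free_elt set \<Rightarrow> 'v \<Rightarrow> 'v) \<Rightarrow> bool" where
  "trivial_module q scale act \<longleftrightarrow>
     vector_space.dim scale (UNIV :: 'v set) = 1 \<and> (\<forall>x\<in>std_gens q. \<forall>v. act x v = v)"

definition eigenspace ::
    "('a::field \<Rightarrow> 'v::ab_group_add \<Rightarrow> 'v) \<Rightarrow> ('v \<Rightarrow> 'v) \<Rightarrow> 'a \<Rightarrow> 'v set" where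
  "eigenspace scale A c = {v. A v = scale c v}"

definition eigenvalues ::
    "('a::field \<Rightarrow> 'v::ab_group_add \<Rightarrow> 'v) \<Rightarrow> ('v \<Rightarrow> 'v) \<Rightarrow> 'a set" where
  "eigenvalues scale A = {c. \<exists>v. v \<noteq> 0 \<and> A v = scale c v}"

definition diagonalizable ::
    "('a::field \<Rightarrow> 'v::ab_group_add \<Rightarrow> 'v) \<Rightarrow> ('v \<Rightarrow> 'v) \<Rightarrow> bool" where
  "diagonalizable scale A \<longleftrightarrow>
     (\<exists>B. \<not> module.dependent scale B \<and> module.span scale B = UNIV \<and>
        (\<forall>b\<in>B. \<exists>c. A b = scale c b))"

definition has_diameter_type ::
    "'a::field \<Rightarrow> ('a \<Rightarrow> 'v::ab_group_add \<Rightarrow> 'v) \<Rightarrow> ('a free_elt set \<Rightarrow> 'v \<Rightarrow> 'v)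
      \<Rightarrow> nat \<Rightarrow> 'a \<Rightarrow> bool" where
  "has_diameter_type q scale act d \<epsilon> \<longleftrightarrow>
     \<epsilon> \<in> {1, -1} \<and>
     (\<forall>x\<in>std_gens q. diagonalizable scale (act x) \<and>
        eigenvalues scale (act x) = {\<epsilon> * q powi (int d - 2 * int n) | n. n \<le> d})"

text \<open>The shape is only defined for modules of type 1.\<close>

definition has_shape ::
    "'a::field \<Rightarrow> ('a \<Rightarrow> 'v::ab_group_add \<Rightarrow> 'v) \<Rightarrow> ('a free_elt set \<Rightarrow> 'v \<Rightarrow> 'v)
      \<Rightarrow> nat list \<Rightarrow> bool" where
  "has_shape q scale act s \<longleftrightarrow>
     (\<exists>d. has_diameter_type q scale act d 1 \<and> length s = d + 1 \<and>
        (\<forall>x\<in>std_gens q. \<forall>n\<le>d.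
           vector_space.dim scale (eigenspace scale (act x) (q powi (int d - 2 * int n))) = s ! n))"

definition evaluation_module ::
    "'a::field \<Rightarrow> ('a \<Rightarrow> 'v::ab_group_add \<Rightarrow> 'v) \<Rightarrow> ('a free_elt set \<Rightarrow> 'v \<Rightarrow> 'v) \<Rightarrow> bool" where
  "evaluation_module q scale act \<longleftrightarrow>
     tetra_module q scale act \<and>
     \<not> trivial_module q scale act \<and>
     finite_dimensional scale \<and>
     irreducible_module q scale act \<and>
     (\<exists>d. has_shape q scale act (replicate (d + 1) 1))"


section \<open>The matrices\<close>

definition Z_mat :: "nat \<Rightarrow> 'a::field mat" where
  "Z_mat d = mat (d + 1) (d + 1) (\<lambda>(i, j). if i + j = d then 1 else 0)"

definition K_mat :: "nat \<Rightarrow> 'a::field \<Rightarrow> 'a mat" where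
  "K_mat d q = mat (d + 1) (d + 1)
     (\<lambda>(i, j). if i = j then q powi (int d - 2 * int i) else 0)"

text \<open>
  The superdiagonal entry in position \<open>(r, c)\<close> with \<open>c = r + 1\<close> is the \<open>(i - 1, i)\<close>-entry for
  \<open>i = c\<close>; the subdiagonal entry with \<open>r = c + 1\<close> is the \<open>(i, i - 1)\<close>-entry for \<open>i = r\<close>.
\<close>

definition E_mat :: "nat \<Rightarrow> 'a::field \<Rightarrow> 'a mat" where
  "E_mat d q = mat (d + 1) (d + 1) (\<lambda>(r, c).
     if r = c then q powi (2 * int r - int d)
     else if c = r + 1 then q powi int d - q powi (2 * int c - 2 - int d)
     else 0)"

definition G_mat :: "nat \<Rightarrow> 'a::field \<Rightarrow> 'a \<Rightarrow> 'a mat" where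
  "G_mat d q t = mat (d + 1) (d + 1) (\<lambda>(r, c).
     if r = c then q powi (2 * int r - int d)
     else if c = r + 1 then
       (q powi int d - q powi (2 * int c - 2 - int d)) * (1 - t * q powi (int d - 2 * int c + 1))
     else 0)"

definition L_mat :: "nat \<Rightarrow> 'a::field \<Rightarrow> 'a \<Rightarrow> 'a mat" where
  "L_mat d q t = mat (d + 1) (d + 1) (\<lambda>(r, c).
     if r = c then q powi (2 * int r - int d)
     else if c = r + 1 then
       (q powi int d - q powi (2 * int c - 2 - int d))
         * inverse (1 - t * q powi (int d - 2 * int c + 1))
     else 0)"

definition S_mat :: "nat \<Rightarrow> 'a::field \<Rightarrow> 'a \<Rightarrow> 'a mat" where
  "S_mat d q t = mat (d + 1) (d + 1) (\<lambda>(r, c).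
     if c = r + 1 then
       (q powi int d - q powi (2 * int c - int d - 2)) * (1 - t * q powi (2 * int c - int d - 1))
     else if r = c + 1 then
       (q powi (2 * int r - int d) - q powi (- int d)) * q powi (2 * int r - int d - 1) * t
     else if r = c then
       q powi int d
         - (q powi (2 * int r - int d) - q powi (- int d)) * q powi (2 * int r - int d - 1) * t
         - (q powi int d - q powi (2 * int r - int d)) * (1 - t * q powi (2 * int r - int d + 1))
     else 0)"

definition inv_mat :: "'a::field mat \<Rightarrow> 'a mat" where
  "inv_mat A = the (mat_inverse A)"


section \<open>The modules V_d(t) and the evaluation parameter\<close>

definition is_basis ::
    "('a::field \<Rightarrow> 'v::ab_group_add \<Rightarrow> 'v) \<Rightarrow> nat \<Rightarrow> (nat \<Rightarrow> 'v) \<Rightarrow> bool" where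
  "is_basis scale d v \<longleftrightarrow>
     inj_on v {..d} \<and> \<not> module.dependent scale (v ` {..d}) \<and> module.span scale (v ` {..d}) = UNIV"

definition represents ::
    "('a::field \<Rightarrow> 'v::ab_group_add \<Rightarrow> 'v) \<Rightarrow> nat \<Rightarrow> (nat \<Rightarrow> 'v) \<Rightarrow> 'a mat \<Rightarrow> ('v \<Rightarrow> 'v) \<Rightarrow> bool" where
  "represents scale d v M A \<longleftrightarrow> (\<forall>n\<le>d. A (v n) = (\<Sum>i\<le>d. scale (M $$ (i, n)) (v i)))"

definition admissible_parameter :: "'a::field \<Rightarrow> nat \<Rightarrow> 'a \<Rightarrow> bool" where
  "admissible_parameter q d t \<longleftrightarrow>
     t \<noteq> 0 \<and> t \<notin> {q powi (int d - 2 * int n + 1) | n. 1 \<le> n \<and> n \<le> d}"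

definition is_V ::
    "'a::field \<Rightarrow> nat \<Rightarrow> 'a \<Rightarrow> ('a \<Rightarrow> 'v::ab_group_add \<Rightarrow> 'v) \<Rightarrow> ('a free_elt set \<Rightarrow> 'v \<Rightarrow> 'v)
      \<Rightarrow> bool" where
  "is_V q d t scale act \<longleftrightarrow>
     evaluation_module q scale act \<and>
     (\<exists>v. is_basis scale d v \<and>
        represents scale d v (Z_mat d * S_mat d (inverse q) (inverse t) * Z_mat d)
          (act (tetra_gen q 0 1)) \<and>
        represents scale d v (E_mat d q) (act (tetra_gen q 1 2)) \<and>
        represents scale d v (K_mat d q) (act (tetra_gen q 2 3)) \<and>
        represents scale d v (Z_mat d * G_mat d (inverse q) t * Z_mat d)
          (act (tetra_gen q 3 0)) \<and>
        represents scale d v (L_mat d q t) (act (tetra_gen q 0 2)) \<and>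
        represents scale d v (inv_mat (Z_mat d * E_mat d (inverse q) * Z_mat d))
          (act (tetra_gen q 1 3)) \<and>
        represents scale d v (inv_mat (L_mat d q t)) (act (tetra_gen q 2 0)) \<and>
        represents scale d v (Z_mat d * E_mat d (inverse q) * Z_mat d) (act (tetra_gen q 3 1)))"

text \<open>
  \<open>V_d(t)\<close> is determined up to isomorphism only, so any module isomorphic to it has the same
  dimension and we may look for \<open>V_d(t)\<close> on the underlying vector space of the given module.
\<close>

definition has_evaluation_parameter ::
    "'a::field \<Rightarrow> ('a \<Rightarrow> 'v::ab_group_add \<Rightarrow> 'v) \<Rightarrow> ('a free_elt set \<Rightarrow> 'v \<Rightarrow> 'v) \<Rightarrow> 'a \<Rightarrow> bool" where
  "has_evaluation_parameter q scale act t \<longleftrightarrow>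
     (\<exists>d\<ge>1. has_diameter_type q scale act d 1 \<and> admissible_parameter q d t \<and>
        (\<exists>act'. is_V q d t scale act' \<and> module_isomorphic q scale act scale act'))"

end

theory Submission
  imports Defs "Jordan_Normal_Form.Determinant"
begin

text \<open>
  The automorphism \<open>\<rho>\<close> permutes the standard generators. Being an evaluation module is a property
  of the submodules and of the eigenspaces of all standard generators, so it survives the twist; the
  diameter \<open>d\<close> survives as well. What has to be found is a basis of \<open>V\<^sub>d(t)\<close> in which the twisted
  action is given by the matrices of \<open>V\<^sub>d(1/t)\<close>.

  On the twisted module \<open>x\<^sub>i\<^sub>j\<close> acts as \<open>x\<^bsub>i-1,j-1\<^esub>\<close> did before. In the defining basis of \<open>V\<^sub>d(1/t)\<close>
  the generator \<open>x\<^sub>2\<^sub>3\<close> is diagonal, so the new basis must consist of eigenvectors of the old \<open>x\<^sub>1\<^sub>2\<close>,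
  whose matrix \<open>E\<^sub>q\<close> is upper bidiagonal. With \<open>\<theta>\<^sub>i = q\<^bsup>2i-d\<^esup>\<close> for the eigenvalues, the coordinates of
  such an eigenvector are \<open>p\<^sub>n(\<theta>\<^sub>i)\<close> for \<open>i = 0, \<dots>, d\<close>, where \<open>p\<^sub>n(x)\<close> is a scalar multiple of
  \<open>\<Prod>m<n. (1/x - \<theta>\<^sub>m)\<close> (\<open>eigpoly\<close>). The scalars are determined by requiring that the old \<open>x\<^sub>2\<^sub>3\<close>, whose
  matrix is \<open>K\<^sub>q\<close>, have in the new basis the matrix of \<open>x\<^sub>3\<^sub>0\<close> on \<open>V\<^sub>d(1/t)\<close>. Let \<open>P\<close> be the matrix of all \<open>p\<^sub>n(\<theta>\<^sub>i)\<close>. As \<open>\<theta>\<^sub>i \<theta>\<^bsub>d-i\<^esub> = 1\<close>, the entry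
  \<open>p\<^sub>n(\<theta>\<^sub>i)\<close> is zero exactly when \<open>i + n > d\<close>; so \<open>P\<close> is triangular with respect to the antidiagonal
  and does lead to a basis (\<open>is_basis_antitriangular\<close>).

  It remains to check that \<open>P\<close> carries each matrix of \<open>V\<^sub>d(t)\<close> to the required matrix of \<open>V\<^sub>d(1/t)\<close>,
  for instance \<open>Z S Z P = P E\<close> for \<open>x\<^sub>0\<^sub>1\<close>. Every matrix involved is tridiagonal, or the inverse of
  a bidiagonal one. A row of \<open>M P\<close> therefore involves \<open>p\<^sub>n\<close> at \<open>\<theta>\<^bsub>i-1\<^esub>\<close>, \<open>\<theta>\<^sub>i\<close>, \<open>\<theta>\<^bsub>i+1\<^esub>\<close>, and a column of
  \<open>P M'\<close> involves \<open>p\<^bsub>n-1\<^esub>\<close>, \<open>p\<^sub>n\<close>, \<open>p\<^bsub>n+1\<^esub>\<close> at \<open>\<theta>\<^sub>i\<close>. The product formula, with its behaviour under a shift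
  of the argument (\<open>p_shift_down\<close>, \<open>p_shift_up\<close>), expresses all these values through one of them,
  and a rational identity is left. The inverse matrices are reduced to the bidiagonal ones by means
  of the relations \<open>x\<^sub>i\<^sub>j x\<^sub>j\<^sub>i = 1\<close> (\<open>represents_inverse_change_basis\<close>).
\<close>

section \<open>Tridiagonal matrices\<close>

text \<open>
  Both off-diagonals are indexed by the larger of row and column, so that \<open>up i\<close> is the
  \<open>(i - 1, i)\<close>-entry and \<open>lo i\<close> the \<open>(i, i - 1)\<close>-entry. The values \<open>lo 0\<close> and \<open>up (d + 1)\<close> then lie
  just outside the matrix; when they vanish, products can be written without boundary cases.
\<close>
definition tridiag :: "nat \<Rightarrow> (nat \<Rightarrow> 'a::field) \<Rightarrow> (nat \<Rightarrow> 'a) \<Rightarrow> (nat \<Rightarrow> 'a) \<Rightarrow> 'a mat" where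
  "tridiag d lo di up = mat (d + 1) (d + 1) (\<lambda>(r, c).
     if r = c then di r else if r = c + 1 then lo r else if c = r + 1 then up c else 0)"

lemma tridiag_carrier [simp]: "tridiag d lo di up \<in> carrier_mat (d + 1) (d + 1)"
  by (simp add: tridiag_def)

lemma sum_band:
  fixes f :: "nat \<Rightarrow> 'a::comm_monoid_add"
  assumes "i \<le> d" and "\<And>k. k \<noteq> i \<Longrightarrow> i \<noteq> k + 1 \<Longrightarrow> k \<noteq> i + 1 \<Longrightarrow> f k = 0"
  shows "(\<Sum>k = 0..<d + 1. f k) =
    (if i = 0 then 0 else f (i - 1)) + f i + (if i = d then 0 else f (i + 1))"
proof -
  have "(\<Sum>k = 0..<d + 1. f k) = (\<Sum>k \<in> {k. k \<le> d \<and> (k = i \<or> i = k + 1 \<or> k = i + 1)}. f k)"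
    by (rule sum.mono_neutral_right) (use assms(2) in auto)
  also have "{k. k \<le> d \<and> (k = i \<or> i = k + 1 \<or> k = i + 1)} =
      (if i = 0 then {} else {i - 1}) \<union> {i} \<union> (if i = d then {} else {i + 1})"
    using assms(1) by auto
  also have "sum f \<dots> = (if i = 0 then 0 else f (i - 1)) + f i + (if i = d then 0 else f (i + 1))"
    by (auto simp: add_ac)
  finally show ?thesis .
qed

lemma tridiag_mult:
  assumes "P \<in> carrier_mat (d + 1) (d + 1)" "i \<le> d" "n \<le> d" "lo 0 = 0" "up (d + 1) = 0"
  shows "(tridiag d lo di up * P) $$ (i, n) =
    lo i * P $$ (i - 1, n) + di i * P $$ (i, n) + up (i + 1) * P $$ (i + 1, n)"
proof -
  have "(tridiag d lo di up * P) $$ (i, n) =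
      (\<Sum>k = 0..<d + 1. tridiag d lo di up $$ (i, k) * P $$ (k, n))"
    using assms by (simp add: scalar_prod_def tridiag_def)
  also have "\<dots> = (\<Sum>k = 0..<d + 1. (if i = k then di i else if i = k + 1 then lo i
      else if k = i + 1 then up k else 0) * P $$ (k, n))"
    by (rule sum.cong) (use assms in \<open>auto simp: tridiag_def\<close>)
  also have "\<dots> = lo i * P $$ (i - 1, n) + di i * P $$ (i, n) + up (i + 1) * P $$ (i + 1, n)"
    using assms by (subst sum_band[of i d]) auto
  finally show ?thesis .
qed

lemma mult_tridiag:
  assumes "P \<in> carrier_mat (d + 1) (d + 1)" "i \<le> d" "n \<le> d"
  shows "(P * tridiag d lo di up) $$ (i, n) =
    (if n = 0 then 0 else P $$ (i, n - 1) * up n) + P $$ (i, n) * di n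
      + (if n = d then 0 else P $$ (i, n + 1) * lo (n + 1))"
proof -
  have "(P * tridiag d lo di up) $$ (i, n) =
      (\<Sum>k = 0..<d + 1. P $$ (i, k) * tridiag d lo di up $$ (k, n))"
    using assms by (simp add: scalar_prod_def tridiag_def)
  also have "\<dots> = (\<Sum>k = 0..<d + 1. P $$ (i, k) * (if k = n then di n else if k = n + 1 then lo k
      else if n = k + 1 then up n else 0))"
    by (rule sum.cong) (use assms in \<open>auto simp: tridiag_def\<close>)
  also have "\<dots> = (if n = 0 then 0 else P $$ (i, n - 1) * up n) + P $$ (i, n) * di n
      + (if n = d then 0 else P $$ (i, n + 1) * lo (n + 1))"
    using assms by (cases n; subst sum_band[of n d]) auto
  finally show ?thesis .
qed

lemma Z_mat_conj:
  assumes M: "M \<in> carrier_mat (d + 1) (d + 1)" and "r \<le> d" "c \<le> d"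
  shows "(Z_mat d * M * Z_mat d) $$ (r, c) = M $$ (d - r, d - c)"
proof -
  have ZM: "(Z_mat d * M) $$ (r, k) = M $$ (d - r, k)" if "k \<le> d" for k
  proof -
    have "(Z_mat d * M) $$ (r, k) = (\<Sum>l = 0..<d + 1. (if r + l = d then 1 else 0) * M $$ (l, k))"
      using assms that by (simp add: scalar_prod_def Z_mat_def)
    also have "\<dots> = (\<Sum>l = 0..<d + 1. if l = d - r then M $$ (l, k) else 0)"
      by (rule sum.cong) (use assms in auto)
    finally show ?thesis by simp
  qed
  have "(Z_mat d * M * Z_mat d) $$ (r, c) =
      (\<Sum>k = 0..<d + 1. (Z_mat d * M) $$ (r, k) * (if k + c = d then 1 else 0))"
    using assms by (simp add: scalar_prod_def Z_mat_def)
  also have "\<dots> = (\<Sum>k = 0..<d + 1. if k = d - c then M $$ (d - r, k) else 0)"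
    by (rule sum.cong) (use assms ZM in auto)
  finally show ?thesis by simp
qed

text \<open>
  Reversing the order of the basis exchanges the two off-diagonals and reflects all indices.
\<close>
lemma Z_mat_conj_tridiag:
  "Z_mat d * tridiag d lo di up * Z_mat d =
     tridiag d (\<lambda>i. up (d + 1 - i)) (\<lambda>i. di (d - i)) (\<lambda>i. lo (d + 1 - i))"
proof (rule eq_matI)
  fix r c
  assume "r < dim_row (tridiag d (\<lambda>i. up (d + 1 - i)) (\<lambda>i. di (d - i)) (\<lambda>i. lo (d + 1 - i)))"
    and "c < dim_col (tridiag d (\<lambda>i. up (d + 1 - i)) (\<lambda>i. di (d - i)) (\<lambda>i. lo (d + 1 - i)))"
  then have rc: "r \<le> d" "c \<le> d" by (simp_all add: tridiag_def)
  show "(Z_mat d * tridiag d lo di up * Z_mat d) $$ (r, c) =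
      tridiag d (\<lambda>i. up (d + 1 - i)) (\<lambda>i. di (d - i)) (\<lambda>i. lo (d + 1 - i)) $$ (r, c)"
  proof -
    consider "r = c" | "r = c + 1" | "c = r + 1" | "r \<noteq> c" "r \<noteq> c + 1" "c \<noteq> r + 1"
      by blast
    then show ?thesis
    proof cases
      case 1
      with rc show ?thesis
        unfolding Z_mat_conj[OF tridiag_carrier rc] by (simp add: tridiag_def)
    next
      case 2
      then have "d + 1 - r = d - c" "d - c = d - r + 1" using rc by simp_all
      with 2 rc show ?thesis
        unfolding Z_mat_conj[OF tridiag_carrier rc] by (simp add: tridiag_def)
    next
      case 3
      then have "d + 1 - c = d - r" "d - r = d - c + 1" using rc by simp_all
      with 3 rc show ?thesis
        unfolding Z_mat_conj[OF tridiag_carrier rc] by (simp add: tridiag_def)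
    next
      case 4
      then have "d - r \<noteq> d - c" "d - r \<noteq> d - c + 1" "d - c \<noteq> d - r + 1" using rc by simp_all
      with 4 rc show ?thesis
        unfolding Z_mat_conj[OF tridiag_carrier rc] by (simp add: tridiag_def)
    qed
  qed
qed (simp_all add: Z_mat_def tridiag_def)

lemma tridiag_cong:
  assumes "\<And>i. i \<le> d \<Longrightarrow> di i = di' i" "\<And>i. 1 \<le> i \<Longrightarrow> i \<le> d \<Longrightarrow> lo i = lo' i"
    "\<And>i. 1 \<le> i \<Longrightarrow> i \<le> d \<Longrightarrow> up i = up' i"
  shows "tridiag d lo di up = tridiag d lo' di' up'"
  using assms by (auto simp: tridiag_def intro!: cong_mat)

section \<open>The matrices in terms of the eigenvalues\<close>

text \<open>
  The common spectrum of the standard generators in increasing powers of \<open>q\<close>. All entries of the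
  matrices are rational in \<open>\<theta>\<^sub>i\<close>, \<open>q\<close>, \<open>q\<^sup>d\<close> and \<open>t\<close>. The eigenvalues do not change when the index is
  reflected and \<open>q\<close> is inverted at the same time. Hence in these terms conjugation by \<open>Z\<close>, combined
  with the inversion of \<open>q\<close>, only interchanges the off-diagonals and replaces \<open>q\<close> and \<open>q\<^sup>d\<close> by their
  inverses.
\<close>
definition \<theta> :: "'a::field \<Rightarrow> nat \<Rightarrow> nat \<Rightarrow> 'a" where
  "\<theta> q d i = q powi (2 * int i - int d)"

lemma \<theta>_eq: "q \<noteq> 0 \<Longrightarrow> \<theta> q d i = q ^ (2 * i) / q ^ d"
  unfolding \<theta>_def
  by (subst power_int_diff) (simp_all, metis of_nat_mult of_nat_numeral power_int_of_nat)

lemma \<theta>_nonzero [simp]: "q \<noteq> 0 \<Longrightarrow> \<theta> q d i \<noteq> 0"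
  by (simp add: \<theta>_eq)

lemma \<theta>_0: "q \<noteq> 0 \<Longrightarrow> \<theta> q d 0 = 1 / q ^ d"
  by (simp add: \<theta>_eq)

lemma \<theta>_Suc: "q \<noteq> 0 \<Longrightarrow> \<theta> q d (Suc i) = q\<^sup>2 * \<theta> q d i"
  by (simp add: \<theta>_eq power2_eq_square)

lemma \<theta>_diff: "q \<noteq> 0 \<Longrightarrow> i \<le> d \<Longrightarrow> \<theta> q d (d - i) = 1 / \<theta> q d i"
  by (simp add: \<theta>_eq power_diff diff_mult_distrib2 mult_2 power_add)

lemma \<theta>_inverse: "q \<noteq> 0 \<Longrightarrow> \<theta> (inverse q) d i = 1 / \<theta> q d i"
  by (simp add: \<theta>_eq power_inverse divide_inverse mult.commute)

lemma \<theta>_reflect: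
  assumes "q \<noteq> 0"
  shows "i \<le> d \<Longrightarrow> \<theta> (inverse q) d (d - i) = \<theta> q d i"
    and "1 \<le> i \<Longrightarrow> i \<le> d \<Longrightarrow> \<theta> (inverse q) d (d + 1 - i) = \<theta> q d i / q\<^sup>2"
proof -
  show 1: "i \<le> d \<Longrightarrow> \<theta> (inverse q) d (d - i) = \<theta> q d i" for i
    using assms by (simp add: \<theta>_inverse \<theta>_diff)
  show "\<theta> (inverse q) d (d + 1 - i) = \<theta> q d i / q\<^sup>2" if "1 \<le> i" "i \<le> d"
    using that assms 1[of "i - 1"] \<theta>_Suc[of q d "i - 1"] by simp
qed

lemma powi_\<theta>:
  assumes "q \<noteq> 0"
  shows "q powi (2 * int i - int d) = \<theta> q d i"
    and "q powi (int d - 2 * int i) = 1 / \<theta> q d i"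
    and "q powi (2 * int i - 2 - int d) = \<theta> q d i / q\<^sup>2"
    and "q powi (2 * int i - int d - 2) = \<theta> q d i / q\<^sup>2"
    and "q powi (2 * int i - int d - 1) = \<theta> q d i / q"
    and "q powi (2 * int i - int d + 1) = \<theta> q d i * q"
    and "q powi (int d - 2 * int i + 1) = q / \<theta> q d i"
proof -
  show 1: "q powi (2 * int i - int d) = \<theta> q d i"
    by (simp add: \<theta>_def)
  show 2: "q powi (int d - 2 * int i) = 1 / \<theta> q d i"
    using power_int_minus[of q "2 * int i - int d"] by (simp add: \<theta>_def inverse_eq_divide)
  have 3: "2 * int i - 2 - int d = 2 * int i - int d - 2" by simp
  show "q powi (2 * int i - 2 - int d) = \<theta> q d i / q\<^sup>2" "q powi (2 * int i - int d - 2) = \<theta> q d i / q\<^sup>2"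
    "q powi (2 * int i - int d - 1) = \<theta> q d i / q"
    unfolding 3 using assms by (simp_all add: power_int_diff[of q "2 * int i - int d"] 1)
  show "q powi (2 * int i - int d + 1) = \<theta> q d i * q"
    "q powi (int d - 2 * int i + 1) = q / \<theta> q d i"
    using assms by (simp_all add: power_int_add[of q _ 1] 1 2)
qed

lemma mat_eq_tridiagI:
  assumes "\<And>i. i \<le> d \<Longrightarrow> f (i, i) = di i"
    and "\<And>i. 1 \<le> i \<Longrightarrow> i \<le> d \<Longrightarrow> f (i, i - 1) = lo i"
    and "\<And>i. 1 \<le> i \<Longrightarrow> i \<le> d \<Longrightarrow> f (i - 1, i) = up i"
    and "\<And>r c. r \<noteq> c \<Longrightarrow> r \<noteq> c + 1 \<Longrightarrow> c \<noteq> r + 1 \<Longrightarrow> f (r, c) = 0"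
  shows "mat (d + 1) (d + 1) f = tridiag d lo di up"
  unfolding tridiag_def
proof (rule cong_mat)
  fix r c assume "r < d + 1" "c < d + 1"
  then show "f (r, c) = (case (r, c) of (r, c) \<Rightarrow>
      if r = c then di r else if r = c + 1 then lo r else if c = r + 1 then up c else 0)"
    using assms(1)[of r] assms(2)[of r] assms(3)[of c] assms(4)[of r c] by auto
qed simp_all

lemma K_mat_tridiag:
  "q \<noteq> 0 \<Longrightarrow> K_mat d q = tridiag d (\<lambda>i. 0) (\<lambda>i. 1 / \<theta> q d i) (\<lambda>i. 0)"
  unfolding K_mat_def by (rule mat_eq_tridiagI) (auto simp: powi_\<theta>)

lemma E_mat_tridiag:
  "q \<noteq> 0 \<Longrightarrow> E_mat d q = tridiag d (\<lambda>i. 0) (\<theta> q d) (\<lambda>i. q ^ d - \<theta> q d i / q\<^sup>2)"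
  unfolding E_mat_def by (rule mat_eq_tridiagI) (auto simp: powi_\<theta>)

lemma G_mat_tridiag:
  "q \<noteq> 0 \<Longrightarrow> G_mat d q t =
    tridiag d (\<lambda>i. 0) (\<theta> q d) (\<lambda>i. (q ^ d - \<theta> q d i / q\<^sup>2) * (1 - t * (q / \<theta> q d i)))"
  unfolding G_mat_def by (rule mat_eq_tridiagI) (auto simp: powi_\<theta>)

lemma L_mat_tridiag:
  "q \<noteq> 0 \<Longrightarrow> L_mat d q t =
    tridiag d (\<lambda>i. 0) (\<theta> q d) (\<lambda>i. (q ^ d - \<theta> q d i / q\<^sup>2) * inverse (1 - t * (q / \<theta> q d i)))"
  unfolding L_mat_def by (rule mat_eq_tridiagI) (auto simp: powi_\<theta>)

lemma S_mat_tridiag: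
  "q \<noteq> 0 \<Longrightarrow> S_mat d q t = tridiag d
    (\<lambda>i. (\<theta> q d i - 1 / q ^ d) * (\<theta> q d i / q) * t)
    (\<lambda>i. q ^ d - (\<theta> q d i - 1 / q ^ d) * (\<theta> q d i / q) * t
         - (q ^ d - \<theta> q d i) * (1 - t * (\<theta> q d i * q)))
    (\<lambda>i. (q ^ d - \<theta> q d i / q\<^sup>2) * (1 - t * (\<theta> q d i / q)))"
  unfolding S_mat_def
  by (rule mat_eq_tridiagI) (auto simp: powi_\<theta> power_int_minus inverse_eq_divide)

lemma ZEZ_tridiag:
  assumes "q \<noteq> 0"
  shows "Z_mat d * E_mat d (inverse q) * Z_mat d =
    tridiag d (\<lambda>i. 1 / q ^ d - \<theta> q d i) (\<theta> q d) (\<lambda>i. 0)"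
  unfolding E_mat_tridiag[OF nonzero_imp_inverse_nonzero[OF assms]] Z_mat_conj_tridiag
proof (rule tridiag_cong, goal_cases)
  case (1 i) then show ?case by (simp only: \<theta>_reflect[OF assms])
next
  case (2 i) then show ?case
    using assms by (simp only: \<theta>_reflect[OF assms]) (simp add: field_simps)
qed simp

lemma ZGZ_tridiag:
  assumes "q \<noteq> 0"
  shows "Z_mat d * G_mat d (inverse q) t * Z_mat d =
    tridiag d (\<lambda>i. (1 / q ^ d - \<theta> q d i) * (1 - t * (q / \<theta> q d i))) (\<theta> q d) (\<lambda>i. 0)"
  unfolding G_mat_tridiag[OF nonzero_imp_inverse_nonzero[OF assms]] Z_mat_conj_tridiag
proof (rule tridiag_cong, goal_cases)
  case (1 i) then show ?case by (simp only: \<theta>_reflect[OF assms])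
next
  case (2 i)
  have "inverse q / (\<theta> q d i / q\<^sup>2) = q / \<theta> q d i"
    "inverse q ^ d - \<theta> q d i / q\<^sup>2 / (inverse q)\<^sup>2 = 1 / q ^ d - \<theta> q d i"
    using assms by (simp_all add: field_simps power2_eq_square)
  with 2 show ?case by (simp only: \<theta>_reflect[OF assms])
qed simp

lemma ZSZ_tridiag:
  assumes "q \<noteq> 0"
  shows "Z_mat d * S_mat d (inverse q) t * Z_mat d = tridiag d
    (\<lambda>i. (1 / q ^ d - \<theta> q d i) * (1 - t * (\<theta> q d i / q)))
    (\<lambda>i. 1 / q ^ d - (\<theta> q d i - q ^ d) * (\<theta> q d i * q) * t
         - (1 / q ^ d - \<theta> q d i) * (1 - t * (\<theta> q d i / q)))
    (\<lambda>i. (\<theta> q d i / q\<^sup>2 - q ^ d) * (\<theta> q d i / q) * t)"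
  unfolding S_mat_tridiag[OF nonzero_imp_inverse_nonzero[OF assms]] Z_mat_conj_tridiag
proof (rule tridiag_cong, goal_cases)
  case (1 i) then show ?case
    by (simp only: \<theta>_reflect[OF assms]) (simp add: divide_inverse power_inverse)
next
  case (2 i)
  have "\<theta> q d i / q\<^sup>2 / inverse q = \<theta> q d i / q"
    "inverse q ^ d - \<theta> q d i / q\<^sup>2 / (inverse q)\<^sup>2 = 1 / q ^ d - \<theta> q d i"
    using assms by (simp_all add: field_simps power2_eq_square)
  with 2 show ?case by (simp only: \<theta>_reflect[OF assms])
next
  case (3 i)
  have "\<theta> q d i / q\<^sup>2 / inverse q = \<theta> q d i / q" "1 / inverse q ^ d = q ^ d"
    using assms by (simp_all add: field_simps power2_eq_square)
  with 3 show ?case by (simp only: \<theta>_reflect[OF assms])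
qed

section \<open>The transition matrix\<close>

text \<open>
  \<open>eigpoly q d t n\<close> is a polynomial of degree \<open>n\<close> in \<open>1 / x\<close>, up to a scalar the shifted factorial
  \<open>\<Prod>m<n. (1 / x - \<theta>\<^sub>m)\<close>. Its values at \<open>x = \<theta>\<^sub>0, \<dots>, \<theta>\<^sub>d\<close> are the coordinates of an eigenvector of the
  bidiagonal matrix \<open>E\<^sub>q\<close>, with eigenvalue \<open>1 / \<theta>\<^sub>n\<close>. The scalar carries the dependence on \<open>t\<close>:
  it is the one for which \<open>K\<^sub>q\<close> acts on these eigenvectors by the matrix \<open>Z G Z\<close> with parameter
  \<open>1 / t\<close>. In the step from \<open>d\<close> to \<open>d + 1\<close> the denominator may vanish; this is harmless because the
  product of \<open>d + 1\<close> factors is zero at every \<open>\<theta>\<^sub>i\<close>.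
\<close>
primrec eigpoly :: "'a::field \<Rightarrow> nat \<Rightarrow> 'a \<Rightarrow> nat \<Rightarrow> 'a \<Rightarrow> 'a" where
  "eigpoly q d t 0 x = 1"
| "eigpoly q d t (Suc n) x =
     q ^ d / ((1 - q\<^sup>2 * q ^ d * \<theta> q d n) * (1 - 1 / (q * t * \<theta> q d n)))
       * (1 / x - \<theta> q d n) * eigpoly q d t n x"

definition transition :: "nat \<Rightarrow> 'a::field \<Rightarrow> 'a \<Rightarrow> 'a mat" where
  "transition d q t = mat (d + 1) (d + 1) (\<lambda>(i, n). eigpoly q d t n (\<theta> q d i))"

lemma transition_carrier [simp]: "transition d q t \<in> carrier_mat (d + 1) (d + 1)"
  by (simp add: transition_def)

section \<open>Rational identities\<close>

text \<open>
  In the following identities \<open>D\<close>, \<open>x\<close> and \<open>v\<close> stand for \<open>q\<^sup>d\<close>, \<open>\<theta>\<^sub>i\<close> and \<open>\<theta>\<^sub>m\<close> with \<open>m = n - 1\<close>; the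
  eigenvalue \<open>\<theta>\<^sub>n\<close> is then \<open>q\<^sup>2 v\<close>. They are what remains of a matrix identity once the common
  factor \<open>p m (\<theta>\<^sub>i)\<close> has been taken out.
\<close>
lemma ZEZ_identity:
  fixes q D x v :: "'a::field"
  assumes "q \<noteq> 0" "D \<noteq> 0" "x \<noteq> 0" "v \<noteq> 0"
  shows "D * ((1 / D - x) * (v * (q\<^sup>2 * D / x - 1)) + (x - q\<^sup>2 * v) * (1 / x - v)) =
    (D - v) * (1 - q\<^sup>2 * D * v)"
  using assms by (simp add: field_simps power2_eq_square)

lemma ZSZ_identity:
  fixes q D x v t :: "'a::field"
  assumes "q \<noteq> 0" "D \<noteq> 0" "x \<noteq> 0" "v \<noteq> 0" "t \<noteq> 0"
  shows "D * ((1 / D - x) * (1 - inverse t * (x / q)) * (v * (q\<^sup>2 * D / x - 1)) +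
      (1 / D - (1 / D - x) * (1 - inverse t * (x / q)) + (q * x / t) * (D - 1 / (q\<^sup>2 * v)) - q\<^sup>2 * v)
        * (1 / x - v)) =
    (D - v) * ((1 - q\<^sup>2 * D * v) * (1 - 1 / (q * t * v)))"
  using assms by (simp add: field_simps power2_eq_square)

lemma ZGZ_identity:
  fixes q D x v t :: "'a::field"
  assumes "q \<noteq> 0" "D \<noteq> 0" "x \<noteq> 0" "v \<noteq> 0" "t \<noteq> 0"
  shows "D * ((1 / D - x) * (1 - t * (q / x)) * (v * (q\<^sup>2 * D / x - 1)) +
      (x - (1 / D - (q\<^sup>2 * v - D) * (q\<^sup>2 * v * q) * t - (1 / D - q\<^sup>2 * v) * (1 - t * (q * v)))
        + t * q * q\<^sup>2 * v * (1 / x - q\<^sup>2 * v)) * (1 / x - v)) =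
    (v - D) * (q * v) * t * ((1 - q\<^sup>2 * D * v) * (1 - 1 / (q * t * v)))"
  using assms by (simp add: field_simps power2_eq_square)

text \<open>
  Here \<open>u\<close> is \<open>\<theta>\<^sub>n\<close>, and \<open>p n (\<theta>\<^sub>i)\<close> has been taken out. The two denominators come from \<open>L\<^sub>q(t)\<close> and from
  the scalars in \<open>p (n + 1)\<close>; abbreviated as \<open>a\<close> and \<open>b\<close>, they make the identity polynomial after
  multiplication by \<open>a * b\<close>.
\<close>
lemma L_identity:
  fixes q t u x :: "'a::field"
  assumes "q \<noteq> 0" "t \<noteq> 0" "u \<noteq> 0" "x \<noteq> 0" "1 - t / (q * x) \<noteq> 0" "1 - 1 / (q * t * u) \<noteq> 0"
  shows "u * (x + 1 / (1 - t / (q * x)) * (1 / u - x)) +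
    1 / (1 - 1 / (q * t * u)) * (x + 1 / (1 - t / (q * x)) * (1 / (q\<^sup>2 * u) - x)) * (1 / x - u) = 1"
proof -
  define a b where "a = 1 - t / (q * x)" and "b = 1 - 1 / (q * t * u)"
  have "a * b * (u * x) + b * (1 - u * x) + (a * x + (1 / (q\<^sup>2 * u) - x)) * (1 / x - u) = a * b"
    using assms(1-4) unfolding a_def b_def by (simp add: field_simps power2_eq_square)
  moreover have "a \<noteq> 0" "b \<noteq> 0" using assms by (simp_all add: a_def b_def)
  moreover have "u * (x + 1 / a * (1 / u - x)) + 1 / b * (x + 1 / a * (c - x)) * (1 / x - u) =
      (a * b * (u * x) + b * (1 - u * x) + (a * x + (c - x)) * (1 / x - u)) / (a * b)" for c
    using assms(3,4) \<open>a \<noteq> 0\<close> \<open>b \<noteq> 0\<close> by (simp add: field_simps)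
  ultimately show ?thesis
    unfolding a_def[symmetric] b_def[symmetric] by simp
qed

section \<open>Properties of the eigenvector polynomials\<close>

locale evaluation_data =
  fixes q t :: "'a::field" and d :: nat
  assumes q_nonzero [simp]: "q \<noteq> 0"
    and not_root_of_unity: "\<And>n. n > 0 \<Longrightarrow> q ^ n \<noteq> 1"
    and admissible: "admissible_parameter q d t"
begin

abbreviation th :: "nat \<Rightarrow> 'a" where "th \<equiv> \<theta> q d"
abbreviation p :: "nat \<Rightarrow> 'a \<Rightarrow> 'a" where "p \<equiv> eigpoly q d t"
abbreviation P :: "'a mat" where "P \<equiv> transition d q t"

definition \<alpha> :: "nat \<Rightarrow> 'a" where
  "\<alpha> n = q ^ d / ((1 - q\<^sup>2 * q ^ d * th n) * (1 - 1 / (q * t * th n)))"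

lemma p_Suc: "p (Suc n) x = \<alpha> n * (1 / x - th n) * p n x"
  by (simp add: \<alpha>_def)

declare eigpoly.simps(2) [simp del]

lemma t_nonzero [simp]: "t \<noteq> 0"
  using admissible by (simp add: admissible_parameter_def)

text \<open>
  The excluded values \<open>q\<^bsup>d-2n+1\<^esup>\<close> are permuted by inversion: \<open>n\<close> goes to \<open>d + 1 - n\<close>.
\<close>
lemma inverse_parameter_admissible: "admissible_parameter q d (inverse t)"
proof -
  have "inverse t \<noteq> q powi (int d - 2 * int n + 1)" if "1 \<le> n" "n \<le> d" for n
  proof
    assume "inverse t = q powi (int d - 2 * int n + 1)"
    then have "inverse (inverse t) = inverse (q powi (int d - 2 * int n + 1))" by simp
    then have "t = q powi (- (int d - 2 * int n + 1))"
      by (simp only: power_int_minus inverse_inverse_eq)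
    also have "- (int d - 2 * int n + 1) = int d - 2 * int (d + 1 - n) + 1"
      using that by (simp add: of_nat_diff)
    finally have "t \<in> {q powi (int d - 2 * int n + 1) |n. 1 \<le> n \<and> n \<le> d}"
      using that by (intro CollectI exI[of _ "d + 1 - n"]) auto
    then show False
      using admissible unfolding admissible_parameter_def by blast
  qed
  then show ?thesis
    by (auto simp: admissible_parameter_def)
qed

lemma admissible_\<theta>:
  assumes "i < d" shows "t \<noteq> q / th (Suc i)"
proof
  assume "t = q / th (Suc i)"
  then have "t = q powi (int d - 2 * int (Suc i) + 1)"
    by (simp only: powi_\<theta>(7)[OF q_nonzero])
  then have "t \<in> {q powi (int d - 2 * int n + 1) |n. 1 \<le> n \<and> n \<le> d}"
    using assms by (intro CollectI exI[of _ "Suc i"]) simp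
  then show False
    using admissible unfolding admissible_parameter_def by blast
qed

text \<open>
  The excluded values of \<open>t\<close> are the zeros of the denominators in \<open>L\<^sub>q(t)\<close>, here indexed by rows. They
  are also the zeros of the denominators in \<open>L\<^sub>q(1/t)\<close>, which reappear in the scalars of \<open>eigpoly\<close>.
\<close>
lemma admissible_factor_L:
  assumes "i < d" shows "1 - t / (q * th i) \<noteq> 0"
proof
  assume "1 - t / (q * th i) = 0"
  then have "t = q * th i" by (simp add: field_simps)
  moreover have "q * th i = q / th (Suc (d - Suc i))"
    using assms \<theta>_diff[of q "Suc (d - Suc i)" d] \<theta>_diff[of q i d] 
    by (simp add: Suc_diff_Suc)
  ultimately show False
    using admissible_\<theta>[of "d - Suc i"] assms by simp
qed

lemma admissible_factor_\<alpha>: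
  assumes "n < d" shows "1 - 1 / (q * t * th n) \<noteq> 0"
proof
  assume "1 - 1 / (q * t * th n) = 0"
  then have "t = 1 / (q * th n)" by (simp add: field_simps)
  then show False
    using admissible_\<theta>[OF assms] by (simp add: \<theta>_Suc power2_eq_square)
qed

lemma q_power_inj: "q ^ m = q ^ n \<longleftrightarrow> m = n"
proof
  have *: "m = n" if "m \<le> n" "q ^ m = q ^ n" for m n
  proof (rule ccontr)
    assume "m \<noteq> n"
    then have "q ^ (n - m) \<noteq> 1" using that by (intro not_root_of_unity) simp
    moreover have "q ^ n = q ^ m * q ^ (n - m)" using that by (metis le_add_diff_inverse power_add)
    ultimately show False using that by simp
  qed
  assume "q ^ m = q ^ n"
  then show "m = n" using *[of m n] *[of n m] by (cases "m \<le> n") simp_all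
qed simp

lemma th_inj: "th m = th n \<longleftrightarrow> m = n"
  by (simp add: \<theta>_eq q_power_inj)

lemma q_factor_\<alpha>: "1 - q\<^sup>2 * q ^ d * th n \<noteq> 0"
proof -
  have "q\<^sup>2 * q ^ d * th n = q ^ (2 * n + 2)"
    by (simp add: \<theta>_eq power_add power2_eq_square)
  then show ?thesis using not_root_of_unity[of "2 * n + 2"] by auto
qed

lemma \<alpha>_nonzero: "n < d \<Longrightarrow> \<alpha> n \<noteq> 0"
  using q_factor_\<alpha> admissible_factor_\<alpha> by (simp add: \<alpha>_def)

lemma p_eq_prod: "p n x = (\<Prod>m<n. \<alpha> m * (1 / x - th m))"
  by (induction n) (simp_all add: p_Suc)

text \<open>
  The factor with \<open>m = d - i\<close> vanishes at \<open>\<theta>\<^sub>i\<close>, because \<open>\<theta>\<^sub>i \<theta>\<^bsub>d-i\<^esub> = 1\<close>. Hence the transition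
  matrix is triangular with respect to the antidiagonal.
\<close>
lemma p_eq_0:
  assumes "i \<le> d" "d < i + n" shows "p n (th i) = 0"
  unfolding p_eq_prod
proof (rule prod_zero)
  show "\<exists>m\<in>{..<n}. \<alpha> m * (1 / th i - th m) = 0"
    using assms by (intro bexI[of _ "d - i"]) (auto simp: \<theta>_diff)
qed simp

lemma p_nonzero:
  assumes "i + n \<le> d" shows "p n (th i) \<noteq> 0"
proof -
  have "1 / th i - th m \<noteq> 0" if "m < n" for m
    using assms that th_inj[of "d - i" m] by (simp add: \<theta>_diff)
  then show ?thesis
    using assms \<alpha>_nonzero by (auto simp: p_eq_prod)
qed

text \<open>
  Up to a scalar the left-hand side is the polynomial of degree \<open>d + 1\<close>, whose roots are
  \<open>\<theta>\<^sub>0, \<dots>, \<theta>\<^sub>d\<close>. It replaces \<open>p_eq_0\<close> at \<open>n = d + 1\<close>, where the scalar itself may be degenerate.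
\<close>
lemma p_last:
  assumes "i \<le> d" shows "(1 / th i - th d) * p d (th i) = 0"
proof (cases "i = 0")
  case True
  then show ?thesis using \<theta>_diff[of q 0 d] by simp
next
  case False
  then show ?thesis using assms by (simp add: p_eq_0)
qed

text \<open>
  The replacement of \<open>x\<close> by \<open>x / q\<^sup>2\<close> or \<open>q\<^sup>2 x\<close>, that is of \<open>\<theta>\<^sub>i\<close> by \<open>\<theta>\<^bsub>i-1\<^esub>\<close> or \<open>\<theta>\<^bsub>i+1\<^esub>\<close>, moves the window
  of roots by one step: one root enters and one leaves.
\<close>
lemma p_shift_down:
  assumes "x \<noteq> 0" shows "p (Suc n) (x / q\<^sup>2) = \<alpha> n * th n * (q\<^sup>2 * q ^ d / x - 1) * p n x"
proof (induction n)
  case 0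
  show ?case using assms by (simp add: p_Suc \<theta>_0 field_simps)
next
  case (Suc n)
  have "p (Suc (Suc n)) (x / q\<^sup>2) = \<alpha> (Suc n) * (q\<^sup>2 / x - q\<^sup>2 * th n) * p (Suc n) (x / q\<^sup>2)"
    using assms by (simp add: p_Suc[of "Suc n"] \<theta>_Suc)
  also have "\<dots> = \<alpha> (Suc n) * (q\<^sup>2 * th n) * (q\<^sup>2 * q ^ d / x - 1) * (\<alpha> n * (1 / x - th n) * p n x)"
    unfolding Suc.IH by (simp add: algebra_simps)
  finally show ?case by (simp add: p_Suc \<theta>_Suc)
qed

lemma p_shift_up:
  assumes "x \<noteq> 0" shows "(q ^ d / x - 1) * p n (q\<^sup>2 * x) = (1 / (th n * x) - 1) * p n x"
proof (induction n)
  case 0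
  show ?case using assms by (simp add: \<theta>_0)
next
  case (Suc n)
  have "(q ^ d / x - 1) * p (Suc n) (q\<^sup>2 * x) =
      \<alpha> n * (1 / (q\<^sup>2 * x) - th n) * ((q ^ d / x - 1) * p n (q\<^sup>2 * x))"
    by (simp add: p_Suc)
  also have "\<dots> = (1 / (q\<^sup>2 * th n * x) - 1) * (\<alpha> n * (1 / x - th n) * p n x)"
    unfolding Suc.IH using assms by (simp add: field_simps)
  finally show ?case by (simp add: p_Suc \<theta>_Suc)
qed

lemma transition_index: "i \<le> d \<Longrightarrow> n \<le> d \<Longrightarrow> P $$ (i, n) = p n (th i)"
  by (simp add: transition_def)

text \<open>
  In the first and the last row one of the arguments \<open>th i / q\<^sup>2\<close>, \<open>q\<^sup>2 * th i\<close> lies outside the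
  spectrum, but the value there is multiplied by \<open>lo 0\<close> or \<open>up (d + 1)\<close>.
\<close>
lemma tridiag_mult_transition:
  assumes "i \<le> d" "n \<le> d" "lo 0 = 0" "up (d + 1) = 0"
  shows "(tridiag d lo di up * P) $$ (i, n) =
    lo i * p n (th i / q\<^sup>2) + di i * p n (th i) + up (i + 1) * p n (q\<^sup>2 * th i)"
proof -
  have "lo i * P $$ (i - 1, n) = lo i * p n (th i / q\<^sup>2)"
    using assms by (cases i) (simp_all add: transition_index \<theta>_Suc)
  moreover have "up (i + 1) * P $$ (i + 1, n) = up (i + 1) * p n (q\<^sup>2 * th i)"
    using assms by (cases "i = d") (simp_all add: transition_index \<theta>_Suc)
  ultimately show ?thesis
    unfolding tridiag_mult[where lo = lo and up = up, OF transition_carrier assms]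
    using assms by (simp only: transition_index)
qed

lemma transition_mult_tridiag:
  assumes "i \<le> d" "n \<le> d"
  shows "(P * tridiag d lo di up) $$ (i, n) =
    (if n = 0 then 0 else up n * p (n - 1) (th i)) + di n * p n (th i)
      + (if n = d then 0 else lo (n + 1) * p (n + 1) (th i))"
  unfolding mult_tridiag[OF transition_carrier assms]
  using assms by (simp add: transition_index mult.commute)

lemma intertwineI:
  assumes "lo 0 = 0" "up (d + 1) = 0"
    and "\<And>i n. i \<le> d \<Longrightarrow> n \<le> d \<Longrightarrow>
      lo i * p n (th i / q\<^sup>2) + di i * p n (th i) + up (i + 1) * p n (q\<^sup>2 * th i) =
      (if n = 0 then 0 else up' n * p (n - 1) (th i)) + di' n * p n (th i)
        + (if n = d then 0 else lo' (n + 1) * p (n + 1) (th i))"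
  shows "tridiag d lo di up * P = P * tridiag d lo' di' up'"
proof (rule eq_matI)
  fix i n
  assume "i < dim_row (P * tridiag d lo' di' up')" "n < dim_col (P * tridiag d lo' di' up')"
  then have "i \<le> d" "n \<le> d" by (simp_all add: transition_def tridiag_def)
  then show "(tridiag d lo di up * P) $$ (i, n) = (P * tridiag d lo' di' up') $$ (i, n)"
    using assms(3) tridiag_mult_transition[of i n lo up di] assms(1,2)
    by (simp only: transition_mult_tridiag)
qed (simp_all add: transition_def tridiag_def)

section \<open>How the generators act on the new basis\<close>

lemma E_up_last: "q ^ d - th (d + 1) / q\<^sup>2 = 0"
  by (simp add: \<theta>_eq mult_2 power_add power2_eq_square)

lemma p_shift_up_cleared:
  "(q ^ d - th i) * p n (q\<^sup>2 * th i) = (1 / th n - th i) * p n (th i)"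
proof -
  have "(q ^ d - th i) * p n (q\<^sup>2 * th i) = th i * ((q ^ d / th i - 1) * p n (q\<^sup>2 * th i))"
    by (simp add: right_diff_distrib left_diff_distrib)
  also have "\<dots> = (1 / th n - th i) * p n (th i)"
    by (subst p_shift_up) (simp_all add: field_simps)
  finally show ?thesis .
qed

lemma E_transition: "E_mat d q * P = P * K_mat d q"
  unfolding E_mat_tridiag[OF q_nonzero] K_mat_tridiag[OF q_nonzero]
proof (rule intertwineI, goal_cases)
  case 2 show ?case by (rule E_up_last)
next
  case (3 i n)
  show ?case using p_shift_up_cleared[of i n] by (simp add: \<theta>_Suc algebra_simps)
qed simp

text \<open>
  The contribution of the entry below the diagonal of the right-hand matrix. It is absent in
  column \<open>d\<close>, which agrees with the generic expression because of \<open>p_last\<close>.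
\<close>
lemma p_raise:
  assumes "i \<le> d" "n \<le> d" and "n < d \<Longrightarrow> c * \<alpha> n = k"
  shows "(if n = d then 0 else c * p (n + 1) (th i)) = k * (1 / th i - th n) * p n (th i)"
proof (cases "n = d")
  case True
  then show ?thesis using p_last[OF assms(1)] by (simp add: mult.assoc)
next
  case False
  then have "c * \<alpha> n = k" using assms by simp
  then show ?thesis using False by (auto simp: p_Suc)
qed

lemma \<alpha>_cancel:
  "n < d \<Longrightarrow> (1 / q ^ d - th (n + 1)) * \<alpha> n = 1 / (1 - 1 / (q * t * th n))"
proof -
  have "(1 / q ^ d - th (n + 1)) * q ^ d = 1 - q\<^sup>2 * q ^ d * th n"
    by (simp add: \<theta>_Suc left_diff_distrib)
  then have "(1 / q ^ d - th (n + 1)) * \<alpha> n =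
      (1 - q\<^sup>2 * q ^ d * th n) / ((1 - q\<^sup>2 * q ^ d * th n) * (1 - 1 / (q * t * th n)))"
    by (simp only: \<alpha>_def times_divide_eq_right)
  also have "\<dots> = 1 / (1 - 1 / (q * t * th n))"
    by (rule nonzero_divide_mult_cancel_left[OF q_factor_\<alpha>])
  finally show ?thesis .
qed

lemma \<alpha>_solve:
  assumes "n < d" "q ^ d * X = Y * ((1 - q\<^sup>2 * q ^ d * th n) * (1 - 1 / (q * t * th n)))"
  shows "\<alpha> n * X = Y"
proof -
  have "(1 - q\<^sup>2 * q ^ d * th n) * (1 - 1 / (q * t * th n)) \<noteq> 0"
    using q_factor_\<alpha>[of n] admissible_factor_\<alpha>[OF assms(1)] by (simp only: mult_eq_0_iff) blast
  then show ?thesis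
    unfolding \<alpha>_def times_divide_eq_left assms(2) by (rule nonzero_mult_div_cancel_right)
qed

text \<open>
  The polynomials \<open>p n (x / q\<^sup>2)\<close> and \<open>p n x\<close> have the common factor \<open>p (n - 1) x\<close>, so it suffices to
  compare the cofactors; the premise is this comparison with the denominators cleared.
\<close>
lemma p_lower:
  assumes "n \<le> d" and "n = 0 \<Longrightarrow> l + e = 0"
    and "\<And>m. n = Suc m \<Longrightarrow>
      q ^ d * (l * (th m * (q\<^sup>2 * q ^ d / th i - 1)) + e * (1 / th i - th m)) =
      Y * ((1 - q\<^sup>2 * q ^ d * th m) * (1 - 1 / (q * t * th m)))"
  shows "l * p n (th i / q\<^sup>2) + e * p n (th i) = (if n = 0 then 0 else Y * p (n - 1) (th i))"
proof (cases n)
  case 0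
  then show ?thesis using assms(2) by simp
next
  case (Suc m)
  define A C where "A = th m * (q\<^sup>2 * q ^ d / th i - 1)" and "C = 1 / th i - th m"
  have "\<alpha> m * (l * A + e * C) = Y"
    unfolding A_def C_def using Suc assms(1) by (intro \<alpha>_solve assms(3)) simp_all
  then have "Y * p m (th i) = \<alpha> m * (l * A + e * C) * p m (th i)" by simp
  moreover have "p n (th i / q\<^sup>2) = \<alpha> m * A * p m (th i)"
    unfolding Suc A_def by (subst p_shift_down) (simp_all add: mult.assoc)
  moreover have "p n (th i) = \<alpha> m * C * p m (th i)"
    unfolding Suc C_def p_Suc ..
  ultimately show ?thesis
    using Suc by (simp add: algebra_simps)
qed

text \<open>
  Bookkeeping for the relations between \<open>tridiag * P\<close> and \<open>P * tridiag\<close>: \<open>A\<close> and \<open>B\<close> are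
  \<open>p n (\<theta>\<^sub>i / q\<^sup>2)\<close> and \<open>p n (\<theta>\<^sub>i)\<close>, while the terms \<open>U\<close> and \<open>R\<close> for \<open>p n (q\<^sup>2 \<theta>\<^sub>i)\<close> and \<open>p (n + 1) (\<theta>\<^sub>i)\<close>
  are themselves multiples of \<open>B\<close>. All multiples of \<open>B\<close> are gathered into the single coefficient \<open>e\<close>,
  so that \<open>p_lower\<close> applies.
\<close>
lemma collect_terms:
  fixes l A e B :: 'a
  assumes "l * A + e * B = Z" "U = c * B" "R = k * B" "x + c = e + u + k"
  shows "l * A + x * B + U = Z + u * B + R"
proof -
  have "l * A + x * B + U = l * A + (x + c) * B" by (simp add: assms(2) algebra_simps)
  also have "\<dots> = Z + u * B + R"
    unfolding assms(3,4) assms(1)[symmetric] by (simp add: algebra_simps)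
  finally show ?thesis .
qed

lemma K_transition: "K_mat d q * P = P * (Z_mat d * G_mat d (inverse q) (inverse t) * Z_mat d)"
  unfolding K_mat_tridiag[OF q_nonzero] ZGZ_tridiag[OF q_nonzero]
proof (rule intertwineI, goal_cases)
  case (3 i n)
  have *: "(1 / q ^ d - th (n + 1)) * (1 - inverse t * (q / th (n + 1))) * \<alpha> n = 1" if "n < d"
  proof -
    have "inverse t * (q / th (n + 1)) = 1 / (q * t * th n)"
      by (simp add: \<theta>_Suc field_simps power2_eq_square)
    then have "(1 / q ^ d - th (n + 1)) * (1 - inverse t * (q / th (n + 1))) * \<alpha> n =
        (1 / q ^ d - th (n + 1)) * \<alpha> n * (1 - 1 / (q * t * th n))"
      by (simp only: mult_ac)
    then show ?thesis
      using admissible_factor_\<alpha>[OF that] unfolding \<alpha>_cancel[OF that] by simp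
  qed
  show ?case
    by (rule collect_terms[where e = 0 and c = 0, OF _ _ p_raise[OF 3 *]]) simp_all
qed simp_all

lemma ZEZ_transition:
  "Z_mat d * E_mat d (inverse q) * Z_mat d * P = P * L_mat d q (inverse t)"
  unfolding L_mat_tridiag[OF q_nonzero] ZEZ_tridiag[OF q_nonzero]
proof (rule intertwineI, goal_cases)
  case (3 i n)
  show ?case
  proof (rule collect_terms[where c = 0 and k = 0, OF p_lower[where e = "th i - th n"]])
    fix m assume m: "n = Suc m"
    have "1 - inverse t * (q / th n) = 1 - 1 / (q * t * th m)"
      unfolding m by (simp add: \<theta>_Suc divide_inverse power2_eq_square)
    moreover have "1 - 1 / (q * t * th m) \<noteq> 0"
      using 3 m by (intro admissible_factor_\<alpha>) simp
    moreover have "q ^ d * ((1 / q ^ d - th i) * (th m * (q\<^sup>2 * q ^ d / th i - 1)) +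
        (th i - th n) * (1 / th i - th m)) = (q ^ d - th n / q\<^sup>2) * (1 - q\<^sup>2 * q ^ d * th m)"
      using ZEZ_identity[of q "q ^ d" "th i" "th m"] unfolding m by (simp add: \<theta>_Suc)
    ultimately show "q ^ d * ((1 / q ^ d - th i) * (th m * (q\<^sup>2 * q ^ d / th i - 1)) +
        (th i - th n) * (1 / th i - th m)) =
        (q ^ d - th n / q\<^sup>2) * inverse (1 - inverse t * (q / th n)) *
        ((1 - q\<^sup>2 * q ^ d * th m) * (1 - 1 / (q * t * th m)))"
      by simp
  qed (use 3 in \<open>simp_all add: \<theta>_0\<close>)
qed (simp_all add: \<theta>_0)

lemma ZSZ_transition:
  "Z_mat d * S_mat d (inverse q) (inverse t) * Z_mat d * P = P * E_mat d q"
  unfolding E_mat_tridiag[OF q_nonzero] ZSZ_tridiag[OF q_nonzero]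
proof (rule intertwineI, goal_cases)
  case 2
  show ?case using E_up_last by simp
next
  case (3 i n)
  define lo where "lo = (1 / q ^ d - th i) * (1 - inverse t * (th i / q))"
  define e where "e = 1 / q ^ d - lo + (q * th i / t) * (q ^ d - 1 / th n) - th n"
  have up: "(th (i + 1) / q\<^sup>2 - q ^ d) * (th (i + 1) / q) * inverse t * p n (q\<^sup>2 * th i) =
      - (q * th i / t) * (1 / th n - th i) * p n (th i)"
  proof -
    have "(th (i + 1) / q\<^sup>2 - q ^ d) * (th (i + 1) / q) * inverse t =
        - (q * th i / t) * (q ^ d - th i)"
      by (simp add: \<theta>_Suc power2_eq_square field_simps)
    then have "(th (i + 1) / q\<^sup>2 - q ^ d) * (th (i + 1) / q) * inverse t * p n (q\<^sup>2 * th i) =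
        - (q * th i / t) * ((q ^ d - th i) * p n (q\<^sup>2 * th i))"
      by (simp only: mult.assoc)
    then show ?thesis unfolding p_shift_up_cleared by (simp only: mult.assoc)
  qed
  show ?case
    unfolding lo_def[symmetric]
  proof (rule collect_terms[OF p_lower[where e = e] up, where k = 0])
    fix m assume m: "n = Suc m"
    have "th n / q\<^sup>2 = th m" "th n = q\<^sup>2 * th m"
      unfolding m by (simp_all add: \<theta>_Suc)
    then show "q ^ d * (lo * (th m * (q\<^sup>2 * q ^ d / th i - 1)) + e * (1 / th i - th m)) =
        (q ^ d - th n / q\<^sup>2) * ((1 - q\<^sup>2 * q ^ d * th m) * (1 - 1 / (q * t * th m)))"
      using ZSZ_identity[of q "q ^ d" "th i" "th m" t] by (simp only: e_def lo_def) simp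
  next
    show "1 / q ^ d - (th i - q ^ d) * (th i * q) * inverse t - lo
        + - (q * th i / t) * (1 / th n - th i) = e + th n + 0"
      by (simp add: e_def field_simps)
  qed (use 3 in \<open>simp_all add: \<theta>_0 e_def\<close>)
qed (simp_all add: \<theta>_0)

lemma ZGZ_transition:
  "Z_mat d * G_mat d (inverse q) t * Z_mat d * P =
    P * (Z_mat d * S_mat d (inverse q) t * Z_mat d)"
  unfolding ZGZ_tridiag[OF q_nonzero] ZSZ_tridiag[OF q_nonzero]
proof (rule intertwineI, goal_cases)
  case (3 i n)
  have *: "(1 / q ^ d - th (n + 1)) * (1 - t * (th (n + 1) / q)) * \<alpha> n = - t * q * th n" if "n < d"
  proof -
    have "th (n + 1) / q = q * th n"
      by (simp add: \<theta>_Suc power2_eq_square)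
    then have "(1 / q ^ d - th (n + 1)) * (1 - t * (th (n + 1) / q)) * \<alpha> n =
        (1 / q ^ d - th (n + 1)) * \<alpha> n * (1 - t * (q * th n))"
      by (simp only: mult_ac)
    also have "\<dots> = - t * q * th n"
      unfolding \<alpha>_cancel[OF that] using admissible_factor_\<alpha>[OF that] by (simp add: field_simps)
    finally show ?thesis .
  qed
  define di where "di = 1 / q ^ d - (th n - q ^ d) * (th n * q) * t
         - (1 / q ^ d - th n) * (1 - t * (th n / q))"
  define e where "e = th i - di + t * q * th n * (1 / th i - th n)"
  show ?case
    unfolding di_def[symmetric]
  proof (rule collect_terms[OF p_lower[where e = e] _ p_raise[OF 3 *], where c = 0])
    fix m assume m: "n = Suc m"
    have "th n / q\<^sup>2 = th m" "th n / q = q * th m" "th n = q\<^sup>2 * th m"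
      unfolding m by (simp_all add: \<theta>_Suc power2_eq_square)
    then show "q ^ d * ((1 / q ^ d - th i) * (1 - t * (q / th i)) *
          (th m * (q\<^sup>2 * q ^ d / th i - 1)) + e * (1 / th i - th m)) =
        (th n / q\<^sup>2 - q ^ d) * (th n / q) * t *
          ((1 - q\<^sup>2 * q ^ d * th m) * (1 - 1 / (q * t * th m)))"
      using ZGZ_identity[of q "q ^ d" "th i" "th m" t]
      unfolding e_def di_def by (simp add: mult.assoc)
  next
    show "th i + 0 = e + di + - t * q * th n * (1 / th i - th n)"
      by (simp add: e_def)
  next
    assume "n = 0"
    then show "(1 / q ^ d - th i) * (1 - t * (q / th i)) + e = 0"
      by (simp add: e_def di_def \<theta>_0 field_simps)
  qed (use 3 in simp_all)
qed (simp_all add: \<theta>_0)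

text \<open>
  Since \<open>x\<^sub>2\<^sub>0\<close> acts by the inverse of \<open>L\<^sub>q(t)\<close>, which is not banded, its action on the new basis is
  expressed through \<open>x\<^sub>0\<^sub>2\<close>: multiplying the intertwining relation by \<open>L\<^sub>q(t)\<close> leaves only banded
  factors.
\<close>
lemma L_ZEZ_transition:
  "L_mat d q t * P * (Z_mat d * E_mat d (inverse q) * Z_mat d) = P"
  unfolding ZEZ_tridiag[OF q_nonzero]
proof (rule eq_matI)
  fix i n assume "i < dim_row P" "n < dim_col P"
  then have i: "i \<le> d" and n: "n \<le> d" by (simp_all add: transition_def)
  define w where "w = inverse (1 - t * (q / th (i + 1)))"
  have LP: "(L_mat d q t * P) $$ (i, k) = (th i + w * (1 / th k - th i)) * p k (th i)"
    if "k \<le> d" for k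
  proof -
    have "(L_mat d q t * P) $$ (i, k) =
        th i * p k (th i) + w * ((q ^ d - th i) * p k (q\<^sup>2 * th i))"
      using E_up_last i that unfolding L_mat_tridiag[OF q_nonzero]
      by (subst tridiag_mult_transition) (simp_all add: w_def \<theta>_Suc)
    then show ?thesis unfolding p_shift_up_cleared by (simp add: algebra_simps)
  qed
  have carrier: "L_mat d q t * P \<in> carrier_mat (d + 1) (d + 1)"
    unfolding L_mat_tridiag[OF q_nonzero]
    by (rule mult_carrier_mat[OF tridiag_carrier transition_carrier])
  have "(th i + w * (1 / th n - th i)) * p n (th i) * th n
      + (if n = d then 0 else (th i + w * (1 / th (n + 1) - th i)) * p (n + 1) (th i)
          * (1 / q ^ d - th (n + 1))) = p n (th i)"
    \<comment> \<open>The denominators are only known to be nonzero for \<open>i < d\<close> and \<open>n < d\<close>. In row \<open>d\<close> and in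
      column \<open>d\<close> this product is zero.\<close>
  proof (cases "(1 / th i - th n) * p n (th i) = 0")
    case True
    then have "p n (th i) = 0 \<or> th n = 1 / th i" by auto
    moreover have "p (n + 1) (th i) = 0" using True by (simp add: p_Suc mult.assoc)
    ultimately show ?thesis by auto
  next
    case False
    have "n \<noteq> d" using p_last[OF i] False by auto
    then have nd: "n < d" using n by simp
    have "i \<noteq> d"
    proof
      assume "i = d"
      then have "n = 0" using False p_eq_0[of d n] by (cases n) auto
      with \<open>i = d\<close> False show False using \<theta>_diff[of q 0 d] by simp
    qed
    then have "i < d" using i by simp
    define s where "s = 1 / (1 - 1 / (q * t * th n))"
    have w: "w = 1 / (1 - t / (q * th i))"
      by (simp add: w_def \<theta>_Suc power2_eq_square divide_inverse)
    have "th n * (th i + w * (1 / th n - th i)) +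
        s * (th i + w * (1 / (q\<^sup>2 * th n) - th i)) * (1 / th i - th n) = 1"
      unfolding w s_def
      by (rule L_identity)
        (use admissible_factor_L[OF \<open>i < d\<close>] admissible_factor_\<alpha>[OF nd] in simp_all)
    then have "p n (th i) = (th n * (th i + w * (1 / th n - th i)) +
        s * (th i + w * (1 / (q\<^sup>2 * th n) - th i)) * (1 / th i - th n)) * p n (th i)"
      by simp
    also have "\<dots> = (th i + w * (1 / th n - th i)) * p n (th i) * th n +
        (th i + w * (1 / th (n + 1) - th i)) * p (n + 1) (th i) * (1 / q ^ d - th (n + 1))"
    proof -
      have *: "(a * A + g * b * B * y) * z = A * z * a + B * (b * y * z) * g" for a b g y z A B :: 'a
        by (simp add: algebra_simps)
      have "q\<^sup>2 * th n = th (n + 1)" by (simp add: \<theta>_Suc)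
      then show ?thesis
        unfolding s_def \<alpha>_cancel[OF nd, symmetric] p_Suc[unfolded Suc_eq_plus1] by (simp only: *)
    qed
    finally show ?thesis using nd by simp
  qed
  moreover have "(if n = d then 0 else (L_mat d q t * P) $$ (i, n + 1) * (1 / q ^ d - th (n + 1))) =
      (if n = d then 0 else (th i + w * (1 / th (n + 1) - th i)) * p (n + 1) (th i)
          * (1 / q ^ d - th (n + 1)))"
    using n LP[of "n + 1"] by simp
  ultimately show
    "(L_mat d q t * P * tridiag d (\<lambda>i. 1 / q ^ d - th i) th (\<lambda>i. 0)) $$ (i, n) = P $$ (i, n)"
    unfolding mult_tridiag[OF carrier i n] transition_index[OF i n] LP[OF n]
    by (simp only: mult_zero_right if_cancel add_0)
qed (simp_all add: transition_def tridiag_def L_mat_def)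

end

section \<open>Change of basis\<close>

lemma index_mult_mat_atMost:
  assumes "X \<in> carrier_mat (d + 1) (d + 1)" "Y \<in> carrier_mat (d + 1) (d + 1)" "i \<le> d" "n \<le> d"
  shows "(X * Y) $$ (i, n) = (\<Sum>k\<le>d. X $$ (i, k) * Y $$ (k, n))"
proof -
  have "{0..<Suc d} = {..d}" by auto
  then show ?thesis using assms by (simp add: scalar_prod_def)
qed

lemma combination_mult:
  fixes v :: "nat \<Rightarrow> 'v::ab_group_add"
  assumes "vector_space scale" "X \<in> carrier_mat (d + 1) (d + 1)" "Y \<in> carrier_mat (d + 1) (d + 1)" "n \<le> d"
  shows "(\<Sum>k\<le>d. scale (Y $$ (k, n)) (\<Sum>i\<le>d. scale (X $$ (i, k)) (v i))) =
    (\<Sum>i\<le>d. scale ((X * Y) $$ (i, n)) (v i))"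
proof -
  interpret vector_space scale by fact
  have "(\<Sum>k\<le>d. scale (Y $$ (k, n)) (\<Sum>i\<le>d. scale (X $$ (i, k)) (v i))) =
      (\<Sum>k\<le>d. \<Sum>i\<le>d. scale (X $$ (i, k) * Y $$ (k, n)) (v i))"
    by (simp add: scale_sum_right mult.commute)
  also have "\<dots> = (\<Sum>i\<le>d. \<Sum>k\<le>d. scale (X $$ (i, k) * Y $$ (k, n)) (v i))"
    by (rule sum.swap)
  also have "\<dots> = (\<Sum>i\<le>d. scale ((X * Y) $$ (i, n)) (v i))"
    using assms by (intro sum.cong) (simp_all add: index_mult_mat_atMost scale_sum_left del: index_mult_mat)
  finally show ?thesis .
qed

lemma represents_apply:
  fixes v :: "nat \<Rightarrow> 'v::ab_group_add"
  assumes lin: "Vector_Spaces.linear scale scale A" and rep: "represents scale d v M A"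
    and "M \<in> carrier_mat (d + 1) (d + 1)" "X \<in> carrier_mat (d + 1) (d + 1)" "n \<le> d"
  shows "A (\<Sum>i\<le>d. scale (X $$ (i, n)) (v i)) = (\<Sum>i\<le>d. scale ((M * X) $$ (i, n)) (v i))"
proof -
  interpret Vector_Spaces.linear scale scale A by (rule lin)
  have "A (\<Sum>i\<le>d. scale (X $$ (i, n)) (v i)) =
      (\<Sum>i\<le>d. scale (X $$ (i, n)) (\<Sum>j\<le>d. scale (M $$ (j, i)) (v j)))"
    using rep by (simp add: represents_def sum scale)
  then show ?thesis
    using assms by (simp add: combination_mult vs1.vector_space_axioms)
qed

lemma represents_change_basis:
  fixes v :: "nat \<Rightarrow> 'v::ab_group_add"
  assumes lin: "Vector_Spaces.linear scale scale A"
    and rep: "represents scale d v M A"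
    and carrier: "M \<in> carrier_mat (d + 1) (d + 1)" "Q \<in> carrier_mat (d + 1) (d + 1)"
      "M' \<in> carrier_mat (d + 1) (d + 1)"
    and eq: "M * Q = Q * M'"
  shows "represents scale d (\<lambda>n. \<Sum>i\<le>d. scale (Q $$ (i, n)) (v i)) M' A"
proof -
  interpret Vector_Spaces.linear scale scale A by (rule lin)
  show ?thesis
    using carrier by (simp add: represents_def represents_apply[OF lin rep] eq
        combination_mult vs1.vector_space_axioms)
qed

text \<open>
  The relation \<open>M Q N = Q\<close> says that \<open>A\<close> maps the vectors with coordinate matrix \<open>Q N\<close> to the new
  basis, so that \<open>B\<close> maps the new basis back to them. The matrix \<open>M\<close> itself is never inverted.
\<close>
lemma represents_inverse_change_basis:
  fixes v :: "nat \<Rightarrow> 'v::ab_group_add"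
  assumes lin: "Vector_Spaces.linear scale scale A" and BA: "\<And>x. B (A x) = x"
    and rep: "represents scale d v M A"
    and carrier: "M \<in> carrier_mat (d + 1) (d + 1)" "Q \<in> carrier_mat (d + 1) (d + 1)"
      "N \<in> carrier_mat (d + 1) (d + 1)"
    and eq: "M * (Q * N) = Q"
  shows "represents scale d (\<lambda>n. \<Sum>i\<le>d. scale (Q $$ (i, n)) (v i)) N B"
  unfolding represents_def
proof (intro allI impI)
  interpret Vector_Spaces.linear scale scale A by (rule lin)
  fix n assume "n \<le> d"
  have "A (\<Sum>i\<le>d. scale ((Q * N) $$ (i, n)) (v i)) = (\<Sum>i\<le>d. scale (Q $$ (i, n)) (v i))"
    using represents_apply[OF lin rep carrier(1) mult_carrier_mat[OF carrier(2,3)] \<open>n \<le> d\<close>]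
    by (simp only: eq)
  then have "B (\<Sum>i\<le>d. scale (Q $$ (i, n)) (v i)) = (\<Sum>i\<le>d. scale ((Q * N) $$ (i, n)) (v i))"
    using BA by metis
  also have "\<dots> = (\<Sum>k\<le>d. scale (N $$ (k, n)) (\<Sum>i\<le>d. scale (Q $$ (i, k)) (v i)))"
    by (rule combination_mult[symmetric, OF vs1.vector_space_axioms carrier(2,3) \<open>n \<le> d\<close>])
  finally show "B (\<Sum>i\<le>d. scale (Q $$ (i, n)) (v i)) =
      (\<Sum>k\<le>d. scale (N $$ (k, n)) (\<Sum>i\<le>d. scale (Q $$ (i, k)) (v i)))" .
qed

text \<open>
  A spanning family with as many members as a basis is a basis.
\<close>
lemma is_basisI:
  fixes w :: "nat \<Rightarrow> 'v::ab_group_add"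
  assumes vs: "vector_space scale" and basis: "is_basis scale d v"
    and span: "module.span scale (w ` {..d}) = UNIV"
  shows "is_basis scale d w"
proof -
  interpret vector_space scale by (rule vs)
  have "card (v ` {..d}) = d + 1"
    using basis by (simp add: is_basis_def card_image)
  have bound: "d + 1 \<le> card T" if "finite T" "span T = UNIV" for T
    using independent_span_bound[OF that(1), of "v ` {..d}"] that(2) basis
      \<open>card (v ` {..d}) = d + 1\<close> by (simp add: is_basis_def)
  have "card (w ` {..d}) \<le> d + 1"
    using card_image_le[of "{..d}" w] by simp
  then have card: "card (w ` {..d}) = d + 1"
    using bound[OF _ span] by simp
  then have "inj_on w {..d}"
    by (intro eq_card_imp_inj_on) simp_all
  moreover have "independent (w ` {..d})"
  proof
    assume "dependent (w ` {..d})"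
    then obtain a where a: "a \<in> w ` {..d}" "a \<in> span (w ` {..d} - {a})"
      by (auto simp: dependent_def)
    then have "span (w ` {..d} - {a}) = UNIV"
      using span span_redundant[OF a(2)] by (simp add: insert_absorb)
    then show False
      using bound[of "w ` {..d} - {a}"] card a(1) by simp
  qed
  ultimately show ?thesis
    using span by (simp add: is_basis_def)
qed

text \<open>
  The vector with number \<open>d - i\<close> is a nonzero multiple of \<open>v i\<close> plus a combination of the \<open>v k\<close> with
  \<open>k < i\<close>, so the old basis can be recovered step by step.
\<close>
lemma is_basis_antitriangular:
  fixes v :: "nat \<Rightarrow> 'v::ab_group_add"
  assumes vs: "vector_space scale" and basis: "is_basis scale d v"
    and zero: "\<And>i n. i \<le> d \<Longrightarrow> n \<le> d \<Longrightarrow> d < i + n \<Longrightarrow> Q $$ (i, n) = 0"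
    and nonzero: "\<And>i. i \<le> d \<Longrightarrow> Q $$ (i, d - i) \<noteq> 0"
  shows "is_basis scale d (\<lambda>n. \<Sum>i\<le>d. scale (Q $$ (i, n)) (v i))" (is "is_basis _ _ ?w")
proof (rule is_basisI[OF vs basis])
  interpret vector_space scale by (rule vs)
  have v_span: "v i \<in> span (?w ` {..d})" if "i \<le> d" for i
    using that
  proof (induction i rule: less_induct)
    case (less i)
    have "?w (d - i) = (\<Sum>k\<in>{..i}. scale (Q $$ (k, d - i)) (v k))"
      using less.prems by (intro sum.mono_neutral_right) (auto simp: zero)
    also have "\<dots> = (\<Sum>k<i. scale (Q $$ (k, d - i)) (v k)) + scale (Q $$ (i, d - i)) (v i)"
      by (simp add: lessThan_Suc_atMost[symmetric])
    finally have "scale (Q $$ (i, d - i)) (v i) =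
        ?w (d - i) - (\<Sum>k<i. scale (Q $$ (k, d - i)) (v k))"
      by simp
    moreover have "?w (d - i) \<in> span (?w ` {..d})"
      by (rule span_base) simp
    moreover have "(\<Sum>k<i. scale (Q $$ (k, d - i)) (v k)) \<in> span (?w ` {..d})"
      using less by (intro span_sum span_scale) simp
    ultimately have "scale (Q $$ (i, d - i)) (v i) \<in> span (?w ` {..d})"
      by (simp only: span_diff)
    then have "scale (inverse (Q $$ (i, d - i))) (scale (Q $$ (i, d - i)) (v i)) \<in> span (?w ` {..d})"
      by (rule span_scale)
    then show ?case using nonzero[OF less.prems] by simp
  qed
  then have "v ` {..d} \<subseteq> span (?w ` {..d})" by auto
  then have "span (v ` {..d}) \<subseteq> span (?w ` {..d})"
    by (rule span_minimal[OF _ subspace_span])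
  then show "span (?w ` {..d}) = UNIV"
    using basis by (auto simp: is_basis_def)
qed

section \<open>Inverses of matrices\<close>

lemma inv_mat_inverse:
  assumes "M \<in> carrier_mat n n" "det M \<noteq> 0"
  shows "M * inv_mat M = 1\<^sub>m n" "inv_mat M \<in> carrier_mat n n"
proof -
  have "mat_inverse M \<noteq> None"
    using mat_inverse(1)[OF assms(1), where b = "()"] det_non_zero_imp_unit[OF assms, of "()"] by blast
  then have "mat_inverse M = Some (inv_mat M)"
    by (auto simp: inv_mat_def)
  then show "M * inv_mat M = 1\<^sub>m n" "inv_mat M \<in> carrier_mat n n"
    using mat_inverse(2)[OF assms(1)] by simp_all
qed

lemma det_tridiag_triangular:
  assumes "(\<forall>i. up i = 0) \<or> (\<forall>i. lo i = 0)" "\<And>i. i \<le> d \<Longrightarrow> di i \<noteq> 0"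
  shows "det (tridiag d lo di up) \<noteq> 0"
proof -
  have "det (tridiag d lo di up) = prod_list (diag_mat (tridiag d lo di up))"
    using assms(1)
  proof
    assume "\<forall>i. up i = 0"
    then show ?thesis
      by (intro det_lower_triangular[OF _ tridiag_carrier]) (simp add: tridiag_def)
  next
    assume "\<forall>i. lo i = 0"
    then show ?thesis
      by (intro det_upper_triangular[OF _ tridiag_carrier] upper_triangularI) (simp add: tridiag_def)
  qed
  then show ?thesis
    using assms(2) by (auto simp: prod_list_zero_iff diag_mat_def tridiag_def)
qed

section \<open>Twisting a module\<close>

lemma tetra_ideal: "ideal (tetra_ideal q) (free_alg :: 'a::field free_elt ring)"
proof -
  interpret ring "free_alg :: 'a free_elt ring" by (rule ring_free_alg)
  show ?thesis
    unfolding tetra_ideal_def by (rule genideal_ideal) (simp add: free_alg_def)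
qed

lemma tetra_coset_in_carrier: "tetra_ideal q +>\<^bsub>free_alg\<^esub> a \<in> carrier (tetra q)"
proof -
  interpret ideal "tetra_ideal q" free_alg by (rule tetra_ideal)
  show ?thesis
    using rcos_ring_hom unfolding tetra_def by (rule ring_hom_closed) (simp add: free_alg_def)
qed

lemma tetra_gen_in_carrier: "tetra_gen q i j \<in> carrier (tetra q)"
  unfolding tetra_gen_def by (rule tetra_coset_in_carrier)

lemma tetra_scalar_in_carrier: "tetra_scalar q c \<in> carrier (tetra q)"
  unfolding tetra_scalar_def by (rule tetra_coset_in_carrier)

lemma tetra_gen_inverse:
  assumes "j - i = 2"
  shows "tetra_gen q i j \<otimes>\<^bsub>tetra q\<^esub> tetra_gen q j i = \<one>\<^bsub>tetra q\<^esub>"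
proof -
  interpret ideal "tetra_ideal q" free_alg by (rule tetra_ideal)
  have carrier: "x \<in> carrier free_alg" for x :: "'a free_elt" by (simp add: free_alg_def)
  note hom = rcos_ring_hom
  have "free_gen i j * free_gen j i - 1 \<in> tetra_ideal q"
  proof -
    have "tetra_rels q \<subseteq> tetra_ideal q"
      unfolding tetra_ideal_def by (rule genideal_self) (simp add: free_alg_def)
    moreover have "free_gen i j * free_gen j i - 1 \<in> tetra_rels q"
      unfolding tetra_rels_def using assms by blast
    ultimately show ?thesis by blast
  qed
  moreover have "(free_gen i j * free_gen j i - 1) \<oplus>\<^bsub>free_alg\<^esub> (1::'a free_elt) = free_gen i j * free_gen j i"
    by (simp add: free_alg_def)
  ultimately have "free_gen i j * free_gen j i \<in> tetra_ideal q +>\<^bsub>free_alg\<^esub> (1::'a free_elt)"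
    unfolding a_r_coset_def' by force
  then have "tetra_ideal q +>\<^bsub>free_alg\<^esub> free_gen i j * free_gen j i =
      tetra_ideal q +>\<^bsub>free_alg\<^esub> (1::'a free_elt)"
    using a_repr_independence[OF _ carrier a_subgroup] by metis
  then show ?thesis
    using ring_hom_mult[OF hom carrier carrier, of "free_gen i j" "free_gen j i"] ring_hom_one[OF hom]
    unfolding tetra_def tetra_gen_def by (simp add: free_alg_def)
qed

lemma inv_into_automorphism:
  assumes "tetra_automorphism q \<pi>"
  defines "\<sigma> \<equiv> inv_into (carrier (tetra q)) \<pi>"
  shows "\<zeta> \<in> carrier (tetra q) \<Longrightarrow> \<sigma> \<zeta> \<in> carrier (tetra q)"
    and "\<zeta> \<in> carrier (tetra q) \<Longrightarrow> \<sigma> (\<pi> \<zeta>) = \<zeta>"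
    and "\<sigma> (tetra_scalar q c) = tetra_scalar q c"
    and "\<sigma> \<in> Ring.ring_hom (tetra q) (tetra q)"
proof -
  have bij: "bij_betw \<pi> (carrier (tetra q)) (carrier (tetra q))"
    and iso: "\<pi> \<in> ring_iso (tetra q) (tetra q)"
    using assms(1) by (simp_all add: tetra_automorphism_def ring_iso_def)
  show 1: "\<zeta> \<in> carrier (tetra q) \<Longrightarrow> \<sigma> \<zeta> \<in> carrier (tetra q)" for \<zeta>
    using bij unfolding \<sigma>_def by (simp add: bij_betw_def inv_into_into)
  show 2: "\<zeta> \<in> carrier (tetra q) \<Longrightarrow> \<sigma> (\<pi> \<zeta>) = \<zeta>" for \<zeta>
    using bij unfolding \<sigma>_def by (simp add: bij_betw_def)
  show "\<sigma> (tetra_scalar q c) = tetra_scalar q c"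
    using 2[OF tetra_scalar_in_carrier, of c] assms(1) by (simp add: tetra_automorphism_def)
  show "\<sigma> \<in> Ring.ring_hom (tetra q) (tetra q)"
    using ring_iso_set_sym[OF ring_tetra iso] by (simp add: \<sigma>_def ring_iso_def)
qed

lemma twist_apply:
  "tetra_automorphism q \<pi> \<Longrightarrow> \<zeta> \<in> carrier (tetra q) \<Longrightarrow> twist q \<pi> act (\<pi> \<zeta>) = act \<zeta>"
  by (simp add: twist_def inv_into_automorphism(2))

lemma twist_tetra_module:
  assumes "tetra_automorphism q \<pi>" "tetra_module q scale act"
  shows "tetra_module q scale (twist q \<pi> act)"
  using assms(2) ring_hom_add[OF inv_into_automorphism(4)[OF assms(1)]]
    ring_hom_mult[OF inv_into_automorphism(4)[OF assms(1)]]
    ring_hom_one[OF inv_into_automorphism(4)[OF assms(1)]]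
  unfolding tetra_module_def twist_def
  by (simp add: inv_into_automorphism(1,3)[OF assms(1)])

lemma twist_irreducible_module:
  assumes "tetra_automorphism q \<pi>" "irreducible_module q scale act"
  shows "irreducible_module q scale (twist q \<pi> act)"
  unfolding irreducible_module_def
proof (intro conjI allI impI)
  show "(UNIV :: 'b set) \<noteq> {0}"
    using assms(2) by (simp add: irreducible_module_def)
next
  fix W assume W: "module.subspace scale W \<and>
    (\<forall>\<zeta>\<in>carrier (tetra q). \<forall>w\<in>W. twist q \<pi> act \<zeta> w \<in> W)"
  have "\<pi> \<zeta> \<in> carrier (tetra q)" if "\<zeta> \<in> carrier (tetra q)" for \<zeta>
    using assms(1) that by (auto simp: tetra_automorphism_def ring_iso_def dest: ring_hom_closed)
  then have "\<forall>\<zeta>\<in>carrier (tetra q). \<forall>w\<in>W. act \<zeta> w \<in> W"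
    using W twist_apply[OF assms(1)] by metis
  then show "W = {0} \<or> W = UNIV"
    using W assms(2) by (simp add: irreducible_module_def)
qed

lemma twist_module_isomorphic:
  assumes "tetra_automorphism q \<pi>" "module_isomorphic q scale act scale' act'"
  shows "module_isomorphic q scale (twist q \<pi> act) scale' (twist q \<pi> act')"
  using assms(2) inv_into_automorphism(1)[OF assms(1)]
  unfolding module_isomorphic_def twist_def by blast

lemma rho_image_std_gens:
  assumes "is_rho q \<rho>" shows "\<rho> ` std_gens q = std_gens q"
proof
  show "\<rho> ` std_gens q \<subseteq> std_gens q"
    using assms by (fastforce simp: is_rho_def std_gens_def)
  show "std_gens q \<subseteq> \<rho> ` std_gens q"
  proof
    fix x assume "x \<in> std_gens q"
    then obtain i j where ij: "x = tetra_gen q i j" "j - i = 1 \<or> j - i = 2"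
      by (auto simp: std_gens_def)
    then have "(j - 1) - (i - 1) = 1 \<or> (j - 1) - (i - 1) = 2" by simp
    then have "\<rho> (tetra_gen q (i - 1) (j - 1)) = x" "tetra_gen q (i - 1) (j - 1) \<in> std_gens q"
      using assms ij(1) unfolding is_rho_def std_gens_def by fastforce+
    then show "x \<in> \<rho> ` std_gens q" by blast
  qed
qed

text \<open>
  Diameter, type, shape and triviality are conditions imposed uniformly on all standard
  generators, and \<open>\<rho>\<close> permutes these. So all of them are invariant under the twist.
\<close>
lemma ball_std_gens_twist:
  assumes "is_rho q \<rho>"
  shows "(\<forall>x\<in>std_gens q. Q (twist q \<rho> act x)) \<longleftrightarrow> (\<forall>x\<in>std_gens q. Q (act x))"
proof -
  have "x \<in> carrier (tetra q)" if "x \<in> std_gens q" for x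
    using that by (auto simp: std_gens_def tetra_gen_in_carrier)
  then have "twist q \<rho> act (\<rho> x) = act x" if "x \<in> std_gens q" for x
    using assms that by (simp add: is_rho_def twist_apply)
  then have "(\<forall>x\<in>\<rho> ` std_gens q. Q (twist q \<rho> act x)) \<longleftrightarrow> (\<forall>x\<in>std_gens q. Q (act x))"
    by simp
  then show ?thesis unfolding rho_image_std_gens[OF assms] .
qed

lemma twist_has_diameter_type:
  assumes "is_rho q \<rho>"
  shows "has_diameter_type q scale (twist q \<rho> act) d \<epsilon> \<longleftrightarrow> has_diameter_type q scale act d \<epsilon>"
  unfolding has_diameter_type_def
  by (subst ball_std_gens_twist[OF assms, where Q = "\<lambda>f. diagonalizable scale f \<and>
    eigenvalues scale f = {\<epsilon> * q powi (int d - 2 * int n) |n. n \<le> d}"]) (rule refl)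

lemma twist_has_shape:
  assumes "is_rho q \<rho>"
  shows "has_shape q scale (twist q \<rho> act) s \<longleftrightarrow> has_shape q scale act s"
  unfolding has_shape_def twist_has_diameter_type[OF assms]
  by (subst ball_std_gens_twist[OF assms, where Q = "\<lambda>f. \<forall>n\<le>d.
    vector_space.dim scale (eigenspace scale f (q powi (int d - 2 * int n))) = s ! n" for d]) (rule refl)

lemma twist_evaluation_module:
  assumes "is_rho q \<rho>" "evaluation_module q scale act"
  shows "evaluation_module q scale (twist q \<rho> act)"
proof -
  have "tetra_automorphism q \<rho>" using assms(1) by (simp add: is_rho_def)
  moreover have "trivial_module q scale (twist q \<rho> act) \<longleftrightarrow> trivial_module q scale act"
    unfolding trivial_module_def
    by (subst ball_std_gens_twist[OF assms(1), where Q = "\<lambda>f. \<forall>v. f v = v"]) (rule refl)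
  ultimately show ?thesis
    using assms(2) unfolding evaluation_module_def
    by (simp add: twist_tetra_module twist_irreducible_module twist_has_shape[OF assms(1)])
qed

lemma twist_tetra_gen:
  assumes "is_rho q \<rho>" "j - i = 1 \<or> j - i = 2"
  shows "twist q \<rho> act (tetra_gen q (i + 1) (j + 1)) = act (tetra_gen q i j)"
  using assms twist_apply[of q \<rho> "tetra_gen q i j" act] tetra_gen_in_carrier[of q i j]
  unfolding is_rho_def by metis

text \<open>
  The twisted action of \<open>x\<^sub>i\<^sub>j\<close> is that of its preimage under \<open>\<rho>\<close>, so the indices move down by one.
\<close>
lemma twist_rho_generators:
  assumes "is_rho q \<rho>"
  shows "twist q \<rho> act (tetra_gen q 0 1) = act (tetra_gen q 3 0)"
    and "twist q \<rho> act (tetra_gen q 1 2) = act (tetra_gen q 0 1)"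
    and "twist q \<rho> act (tetra_gen q 2 3) = act (tetra_gen q 1 2)"
    and "twist q \<rho> act (tetra_gen q 3 0) = act (tetra_gen q 2 3)"
    and "twist q \<rho> act (tetra_gen q 0 2) = act (tetra_gen q 3 1)"
    and "twist q \<rho> act (tetra_gen q 1 3) = act (tetra_gen q 0 2)"
    and "twist q \<rho> act (tetra_gen q 2 0) = act (tetra_gen q 1 3)"
    and "twist q \<rho> act (tetra_gen q 3 1) = act (tetra_gen q 2 0)"
proof -
  have sums: "(0::4) + 1 = 1" "(1::4) + 1 = 2" "(2::4) + 1 = 3" "(3::4) + 1 = 0"
    by simp_all
  note shift = twist_tetra_gen[OF assms, of _ _ act]
  show "twist q \<rho> act (tetra_gen q 0 1) = act (tetra_gen q 3 0)"
    using shift[of 0 3, unfolded sums] by simp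
  show "twist q \<rho> act (tetra_gen q 1 2) = act (tetra_gen q 0 1)"
    using shift[of 1 0, unfolded sums] by simp
  show "twist q \<rho> act (tetra_gen q 2 3) = act (tetra_gen q 1 2)"
    using shift[of 2 1, unfolded sums] by simp
  show "twist q \<rho> act (tetra_gen q 3 0) = act (tetra_gen q 2 3)"
    using shift[of 3 2, unfolded sums] by simp
  show "twist q \<rho> act (tetra_gen q 0 2) = act (tetra_gen q 3 1)"
    using shift[of 1 3, unfolded sums] by simp
  show "twist q \<rho> act (tetra_gen q 1 3) = act (tetra_gen q 0 2)"
    using shift[of 2 0, unfolded sums] by simp
  show "twist q \<rho> act (tetra_gen q 2 0) = act (tetra_gen q 1 3)"
    using shift[of 3 1, unfolded sums] by simp
  show "twist q \<rho> act (tetra_gen q 3 1) = act (tetra_gen q 2 0)"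
    using shift[of 0 2, unfolded sums] by simp
qed

section \<open>The evaluation parameter of the twisted module\<close>

context evaluation_data
begin

text \<open>
  The new basis consists of eigenvectors of \<open>x\<^sub>1\<^sub>2\<close>, since \<open>x\<^sub>2\<^sub>3\<close> acts on the twisted module as \<open>x\<^sub>1\<^sub>2\<close> on
  the original one and has to become the diagonal matrix \<open>K\<^sub>q\<close>.
\<close>
lemma twist_is_V:
  fixes scale :: "'a \<Rightarrow> 'v::ab_group_add \<Rightarrow> 'v"
  assumes rho: "is_rho q \<rho>" and V: "is_V q d t scale act"
  shows "is_V q d (inverse t) scale (twist q \<rho> act)"
proof -
  let ?ZEZ = "Z_mat d * E_mat d (inverse q) * Z_mat d"
  let ?L' = "L_mat d q (inverse t)"
  have module: "tetra_module q scale act"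
    using V by (simp add: is_V_def evaluation_module_def)
  then have vs: "vector_space scale"
    by (simp add: tetra_module_def)
  have lin: "Vector_Spaces.linear scale scale (act (tetra_gen q i j))" for i j
    using module tetra_gen_in_carrier by (auto simp: tetra_module_def)
  have inverse: "act (tetra_gen q j i) (act (tetra_gen q i j) x) = x" if "i - j = 2" for i j x
    using module tetra_gen_inverse[OF that, of q] tetra_gen_in_carrier[of q]
    unfolding tetra_module_def by metis
  obtain v where basis: "is_basis scale d v"
    and x01: "represents scale d v (Z_mat d * S_mat d (inverse q) (inverse t) * Z_mat d) (act (tetra_gen q 0 1))"
    and x12: "represents scale d v (E_mat d q) (act (tetra_gen q 1 2))"
    and x23: "represents scale d v (K_mat d q) (act (tetra_gen q 2 3))"
    and x30: "represents scale d v (Z_mat d * G_mat d (inverse q) t * Z_mat d) (act (tetra_gen q 3 0))"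
    and x02: "represents scale d v (L_mat d q t) (act (tetra_gen q 0 2))"
    and x31: "represents scale d v ?ZEZ (act (tetra_gen q 3 1))"
    using V unfolding is_V_def by blast
  define w where "w = (\<lambda>n. \<Sum>i\<le>d. scale (P $$ (i, n)) (v i))"
  have w_basis: "is_basis scale d w"
    unfolding w_def
    by (rule is_basis_antitriangular[OF vs basis]) (simp_all add: transition_index p_eq_0 p_nonzero)
  have carriers: "E_mat d q \<in> carrier_mat (d + 1) (d + 1)" "K_mat d q \<in> carrier_mat (d + 1) (d + 1)"
    "L_mat d q s \<in> carrier_mat (d + 1) (d + 1)" "?ZEZ \<in> carrier_mat (d + 1) (d + 1)"
    "Z_mat d * G_mat d (inverse q) s * Z_mat d \<in> carrier_mat (d + 1) (d + 1)"
    "Z_mat d * S_mat d (inverse q) s * Z_mat d \<in> carrier_mat (d + 1) (d + 1)" for s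
    unfolding E_mat_tridiag[OF q_nonzero] K_mat_tridiag[OF q_nonzero] L_mat_tridiag[OF q_nonzero]
      ZEZ_tridiag[OF q_nonzero] ZGZ_tridiag[OF q_nonzero] ZSZ_tridiag[OF q_nonzero]
    by (rule tridiag_carrier)+
  note change = represents_change_basis[OF lin _ _ transition_carrier]
  have "det ?ZEZ \<noteq> 0"
    unfolding ZEZ_tridiag[OF q_nonzero] by (rule det_tridiag_triangular) simp_all
  note inv_ZEZ = inv_mat_inverse[OF carriers(4) this]
  have "det ?L' \<noteq> 0"
    unfolding L_mat_tridiag[OF q_nonzero] by (rule det_tridiag_triangular) simp_all
  note inv_L' = inv_mat_inverse[OF carriers(3) this]
  have L_inv: "L_mat d q t * P = P * inv_mat ?ZEZ"
  proof -
    have LP: "L_mat d q t * P \<in> carrier_mat (d + 1) (d + 1)"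
      by (rule mult_carrier_mat[OF carriers(3) transition_carrier])
    have "P * inv_mat ?ZEZ = L_mat d q t * P * ?ZEZ * inv_mat ?ZEZ"
      by (simp only: L_ZEZ_transition)
    also have "\<dots> = L_mat d q t * P"
      unfolding assoc_mult_mat[OF LP carriers(4) inv_ZEZ(2)] inv_ZEZ(1) by (rule right_mult_one_mat[OF LP])
    finally show ?thesis ..
  qed
  have ZEZ_inv: "?ZEZ * (P * inv_mat ?L') = P"
  proof -
    have "?ZEZ * (P * inv_mat ?L') = P * ?L' * inv_mat ?L'"
      unfolding ZEZ_transition[symmetric]
      by (rule assoc_mult_mat[symmetric, OF carriers(4) transition_carrier inv_L'(2)])
    also have "\<dots> = P"
      unfolding assoc_mult_mat[OF transition_carrier carriers(3) inv_L'(2)] inv_L'(1)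
      by (rule right_mult_one_mat[OF transition_carrier])
    finally show ?thesis .
  qed
  have L_ZEZ: "L_mat d q t * (P * ?ZEZ) = P"
    using assoc_mult_mat[OF carriers(3) transition_carrier carriers(4)] L_ZEZ_transition by metis
  have "represents scale d w (Z_mat d * S_mat d (inverse q) t * Z_mat d) (act (tetra_gen q 3 0))"
    unfolding w_def by (rule change[OF x30 carriers(5,6) ZGZ_transition])
  moreover have "represents scale d w (E_mat d q) (act (tetra_gen q 0 1))"
    unfolding w_def by (rule change[OF x01 carriers(6,1) ZSZ_transition])
  moreover have "represents scale d w (K_mat d q) (act (tetra_gen q 1 2))"
    unfolding w_def by (rule change[OF x12 carriers(1,2) E_transition])
  moreover have "represents scale d w (Z_mat d * G_mat d (inverse q) (inverse t) * Z_mat d)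
      (act (tetra_gen q 2 3))"
    unfolding w_def by (rule change[OF x23 carriers(2,5) K_transition])
  moreover have "represents scale d w ?L' (act (tetra_gen q 3 1))"
    unfolding w_def by (rule change[OF x31 carriers(4,3) ZEZ_transition])
  moreover have "represents scale d w (inv_mat ?ZEZ) (act (tetra_gen q 0 2))"
    unfolding w_def by (rule change[OF x02 carriers(3) inv_ZEZ(2) L_inv])
  moreover have "represents scale d w (inv_mat ?L') (act (tetra_gen q 1 3))"
    unfolding w_def
    by (rule represents_inverse_change_basis[OF lin inverse x31 carriers(4) transition_carrier
          inv_L'(2) ZEZ_inv]) simp
  moreover have "represents scale d w ?ZEZ (act (tetra_gen q 2 0))"
    unfolding w_def
    by (rule represents_inverse_change_basis[OF lin inverse x02 carriers(3) transition_carrier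
          carriers(4) L_ZEZ]) simp
  moreover have "evaluation_module q scale (twist q \<rho> act)"
    using V by (intro twist_evaluation_module[OF rho]) (simp add: is_V_def)
  ultimately show ?thesis
    unfolding is_V_def twist_rho_generators[OF rho] inverse_inverse_eq
    using w_basis by blast
qed

end

theorem lemma9p17:
  fixes q t :: "'a::alg_closed_field"
    and scale :: "'a \<Rightarrow> 'v::ab_group_add \<Rightarrow> 'v"
    and act :: "'a free_elt set \<Rightarrow> 'v \<Rightarrow> 'v"
    and \<rho> :: "'a free_elt set \<Rightarrow> 'a free_elt set"
  assumes "q \<noteq> 0"
    and "\<forall>n>0. q ^ n \<noteq> 1"
    and "is_rho q \<rho>"
    and "evaluation_module q scale act"
    and "has_evaluation_parameter q scale act t"
  shows "evaluation_module q scale (twist q \<rho> act) \<and>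
         has_evaluation_parameter q scale (twist q \<rho> act) (inverse t)"
proof
  show "evaluation_module q scale (twist q \<rho> act)"
    by (rule twist_evaluation_module[OF assms(3,4)])
next
  obtain d act' where d: "d \<ge> 1" "has_diameter_type q scale act d 1"
    and adm: "admissible_parameter q d t"
    and V: "is_V q d t scale act'" and iso: "module_isomorphic q scale act scale act'"
    using assms(5) by (auto simp: has_evaluation_parameter_def)
  interpret evaluation_data q t d
    using assms(1,2) adm by unfold_locales simp_all
  have "is_V q d (inverse t) scale (twist q \<rho> act')"
    by (rule twist_is_V[OF assms(3) V])
  moreover have "module_isomorphic q scale (twist q \<rho> act) scale (twist q \<rho> act')"
    using assms(3) iso by (intro twist_module_isomorphic) (simp_all add: is_rho_def)
  ultimately show "has_evaluation_parameter q scale (twist q \<rho> act) (inverse t)"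
    unfolding has_evaluation_parameter_def
    using d inverse_parameter_admissible twist_has_diameter_type[OF assms(3)] by blast
qed

end
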